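(* Let $G$ be a planar triangulation with $n$ vertices and let $M$ be a matching in $G$. Then $G$ has a polychromatic $2$-coloring with discrepancy at most $n-\frac{4}{3}|M|$.
   Context: Graphs are finite and simple. A planar triangulation is a simple plane graph (planar graph with a fixed embedding) in which every face, including the outer face, is bounded by a triangle. A matching is a set of pairwise vertex-disjoint edges. A polychromatic $2$-coloring of $G$ is an assignment of one of two colors to each vertex (not necessarily a proper coloring) such that no face of $G$ is monochromatic. The discrepancy of a $2$-coloring with color classes $R$ and $B$ is $\big||R|-|B|\big|$. *)

theory Defs
  imports "HOL-Analysis.Analysis"
begin

locale simple_graph =
  fixes V :: "'v set" and E :: "'v set set"
  assumes finite_vertices: "finite V"
    and edge_subset: "e \<in> E \<Longrightarrow> e \<subseteq> V"
    and edge_card: "e \<in> E \<Longrightarrow> card e = 2"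

definition matching :: "'v set set \<Rightarrow> 'v set set \<Rightarrow> bool" where
  "matching E M \<longleftrightarrow> M \<subseteq> E \<and> pairwise disjnt M"

text \<open>The plane is the type of complex numbers. Edges are drawn as arbitrary (not
  necessarily polygonal) arcs, which meet vertices and each other only at common ends.\<close>

locale plane_graph = simple_graph V E
  for V :: "'v set" and E :: "'v set set" +
  fixes pos :: "'v \<Rightarrow> complex" and curve :: "'v set \<Rightarrow> real \<Rightarrow> complex"
  assumes pos_inj: "inj_on pos V"
    and curve_arc: "e \<in> E \<Longrightarrow> arc (curve e)"
    and curve_ends: "e \<in> E \<Longrightarrow> {pathstart (curve e), pathfinish (curve e)} = pos ` e"
    and curve_avoids: "\<lbrakk>e \<in> E; v \<in> V; pos v \<in> path_image (curve e)\<rbrakk> \<Longrightarrow> v \<in> e"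
    and curves_meet: "\<lbrakk>e \<in> E; f \<in> E; e \<noteq> f\<rbrakk>
      \<Longrightarrow> path_image (curve e) \<inter> path_image (curve f) \<subseteq> pos ` (e \<inter> f)"
begin

definition drawing :: "complex set" where
  "drawing = pos ` V \<union> (\<Union>e\<in>E. path_image (curve e))"

text \<open>The outer face is the unbounded component.\<close>

definition faces :: "complex set set" where
  "faces = components (- drawing)"

definition face_vertices :: "complex set \<Rightarrow> 'v set" where
  "face_vertices F = {v \<in> V. pos v \<in> frontier F}"

definition bounded_by_triangle :: "complex set \<Rightarrow> bool" where
  "bounded_by_triangle F \<longleftrightarrow>
    (\<exists>a b c. a \<noteq> b \<and> b \<noteq> c \<and> a \<noteq> c \<and> {{a, b}, {b, c}, {a, c}} \<subseteq> E \<and>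
      frontier F = (\<Union>e\<in>{{a, b}, {b, c}, {a, c}}. path_image (curve e)))"

definition monochromatic_face :: "('v \<Rightarrow> bool) \<Rightarrow> complex set \<Rightarrow> bool" where
  "monochromatic_face col F \<longleftrightarrow>
    (\<forall>u\<in>face_vertices F. \<forall>v\<in>face_vertices F. col u = col v)"

definition polychromatic :: "('v \<Rightarrow> bool) \<Rightarrow> bool" where
  "polychromatic col \<longleftrightarrow> (\<forall>F\<in>faces. \<not> monochromatic_face col F)"

end

locale planar_triangulation = plane_graph +
  assumes faces_triangular: "F \<in> faces \<Longrightarrow> bounded_by_triangle F"

definition discrepancy :: "'v set \<Rightarrow> ('v \<Rightarrow> bool) \<Rightarrow> int" where
  "discrepancy V col = \<bar>int (card {v \<in> V. col v}) - int (card {v \<in> V. \<not> col v})\<bar>"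

end

theory Submission
  imports Defs
begin

text \<open>Colorings in which every triangle has exactly one monochromatic edge correspond to perfect
  matchings \<open>J\<close> (the monochromatic edges) of the dual graph, which is cubic and has no cut of size one.
  If \<open>J\<close> contains at most a third of \<open>M\<close>, then at least \<open>2/3 |M|\<close> disjoint edges are bichromatic and do
  not contribute to the discrepancy. Such a \<open>J\<close> is a join of minimum weight, where edges of \<open>M\<close> are
  slightly heavier than the others: since all odd cuts of the dual graph have at least three edges,
  a minimum-weight join has at most a third of the total weight. This is the inequality needed from
  Seymour's theorem on packing \<open>T\<close>-cuts, and the argument follows Sebo's proof of that theorem.
  The Jordan curve theorem turns the faces inside a cycle of the graph into a cut of the dual graph,
  so the complement of \<open>J\<close>, which is even on every face, is even on every cycle and hence a cut.\<close>

section \<open>Light joins in multigraphs\<close>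

text \<open>The third comes from weight 1/3 on each dual edge: since odd cuts have at least three
  edges, this vector lies in the perfect matching polytope, so some perfect matching has at most a
  third of the total weight. To avoid polyhedral theory, joins replace perfect matchings: they form
  a coset under symmetric difference and so allow exchanges. Perfection is recovered by counting: a
  join that is odd on every face has at least half as many edges as there are faces, with equality
  only for perfect matchings. A large common base weight forces equality, and the small surplus on
  \<open>M\<close> then bounds \<open>J \<inter> M\<close>. An exchange removes two crossings of a
  cut and must save weight two, while minimality gives only a strict decrease. Parity supplies the
  missing unit; hence weights that are even on cycles are treated before general ones. Edges are
  arbitrary arcs, so even the fact that an edge borders exactly two faces needs a topological
  proof.\<close>

lemma odd_card_sym_diff:
  assumes "finite A" "finite B"
  shows "odd (card (sym_diff A B)) \<longleftrightarrow> odd (card A) \<noteq> odd (card B)"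
proof -
  have "card (sym_diff A B) = card (A - B) + card (B - A)"
    using assms by (intro card_Un_disjoint) auto
  moreover have "card A = card (A - B) + card (A \<inter> B)" "card B = card (B - A) + card (A \<inter> B)"
    using assms card_Int_Diff[of A B] card_Int_Diff[of B A] by (simp_all add: Int_commute)
  ultimately show ?thesis
    by presburger
qed

lemma sum_sym_diff_nat:
  fixes w :: "'a \<Rightarrow> nat"
  assumes "finite A" "finite B"
  shows "sum w (sym_diff A B) + 2 * sum w (A \<inter> B) = sum w A + sum w B"
proof -
  have "sum w (sym_diff A B) = sum w (A - B) + sum w (B - A)"
    using assms by (intro sum.union_disjoint) auto
  moreover have "sum w A = sum w (A \<inter> B) + sum w (A - B)"
    using assms by (simp add: sum.Int_Diff)
  moreover have "sum w B = sum w (A \<inter> B) + sum w (B - A)"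
    using assms by (metis sum.Int_Diff inf_commute)
  ultimately show ?thesis
    by simp
qed

section \<open>Boundaries modulo 2, cuts and reachability\<close>

locale multigraph =
  fixes V :: "'v set" and E :: "'e set" and inc :: "'e \<Rightarrow> 'v set"
  assumes finite_V: "finite V" and finite_E: "finite E"
    and inc_subset: "e \<in> E \<Longrightarrow> inc e \<subseteq> V"
    and card_inc: "e \<in> E \<Longrightarrow> card (inc e) = 2"
begin

definition bd :: "'e set \<Rightarrow> 'v \<Rightarrow> bool" where
  "bd D v \<longleftrightarrow> odd (card {e \<in> D. v \<in> inc e})"

definition cut :: "'v set \<Rightarrow> 'e set" where
  "cut U = {e \<in> E. card (inc e \<inter> U) = 1}"

text \<open>Connected components without paths: \<open>v\<close> is reached if some part of
  \<open>D\<close> has boundary \<open>b + v\<close> modulo 2, which is zero for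
  \<open>v = b\<close>. Paths are concatenated by symmetric difference.\<close>

definition reach :: "'e set \<Rightarrow> 'v \<Rightarrow> 'v set" where
  "reach D b = {v. \<exists>Q\<subseteq>D. \<forall>x. bd Q x = ((x = b) \<noteq> (x = v))}"

lemma finite_sub: "D \<subseteq> E \<Longrightarrow> finite D"
  using finite_E finite_subset by blast

lemma bd_sym_diff:
  assumes "A \<subseteq> E" "B \<subseteq> E"
  shows "bd (sym_diff A B) v \<longleftrightarrow> bd A v \<noteq> bd B v"
proof -
  have "{e \<in> sym_diff A B. v \<in> inc e} = sym_diff {e \<in> A. v \<in> inc e} {e \<in> B. v \<in> inc e}"
    by auto
  then show ?thesis
    using assms by (simp add: bd_def odd_card_sym_diff finite_sub)
qed

lemma bd_empty [simp]: "\<not> bd {} v"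
  by (simp add: bd_def)

lemma bd_singleton [simp]: "bd {e} v \<longleftrightarrow> v \<in> inc e"
proof -
  have "{e' \<in> {e}. v \<in> inc e'} = (if v \<in> inc e then {e} else {})"
    by auto
  then show ?thesis
    by (simp add: bd_def)
qed

lemma bd_in_V: "D \<subseteq> E \<Longrightarrow> bd D v \<Longrightarrow> v \<in> V"
  unfolding bd_def using inc_subset odd_card_imp_not_empty by fastforce

lemma cut_endpoints:
  assumes "e \<in> cut U"
  obtains a b where "inc e = {a, b}" "a \<in> U" "b \<notin> U"
proof -
  have "e \<in> E" "card (inc e \<inter> U) = 1"
    using assms by (auto simp: cut_def)
  then obtain a b where ab: "inc e = {a, b}" "a \<noteq> b"
    using card_inc[of e] by (auto simp: card_2_iff)
  consider "a \<in> U" "b \<in> U" | "a \<in> U" "b \<notin> U" | "a \<notin> U" "b \<in> U" | "a \<notin> U" "b \<notin> U"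
    by blast
  then show thesis
  proof cases
    case 1
    then have "inc e \<inter> U = {a, b}" using ab by auto
    then show ?thesis using ab \<open>card (inc e \<inter> U) = 1\<close> by simp
  next
    case 4
    then have "inc e \<inter> U = {}" using ab by auto
    then show ?thesis using \<open>card (inc e \<inter> U) = 1\<close> by simp
  next
    case 2
    then show ?thesis using ab that by blast
  next
    case 3
    then show ?thesis using ab that[of b a] by blast
  qed
qed

lemma cut_outside:
  assumes "e \<in> cut U"
  shows "\<exists>b. inc e - U = {b}"
proof -
  obtain a b where "inc e = {a, b}" "a \<in> U" "b \<notin> U"
    using assms by (rule cut_endpoints)
  then have "inc e - U = {b}" by auto
  then show ?thesis by blast
qed

lemma not_cut_iff:
  assumes "e \<in> E" "e \<notin> cut U" "u \<in> inc e" "v \<in> inc e"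
  shows "u \<in> U \<longleftrightarrow> v \<in> U"
proof (rule ccontr)
  assume *: "(u \<in> U) \<noteq> (v \<in> U)"
  then have "u \<noteq> v" by auto
  then have "inc e = {u, v}"
    using assms card_inc[of e] by (auto simp: card_2_iff)
  then have "inc e \<inter> U = {u} \<or> inc e \<inter> U = {v}"
    using * by auto
  then show False
    using assms by (auto simp: cut_def)
qed

text \<open>Count incidences between \<open>D\<close> and \<open>U\<close>: an edge contributes 1 if
  it is in the cut, and 0 or 2 otherwise.\<close>

lemma handshake:
  assumes "D \<subseteq> E" "U \<subseteq> V"
  shows "odd (card {v \<in> U. bd D v}) \<longleftrightarrow> odd (card (D \<inter> cut U))"
proof -
  have fin: "finite U" "finite D"
    using assms finite_V finite_E finite_subset by blast+
  have "(\<Sum>v\<in>U. card {e \<in> D. v \<in> inc e}) = (\<Sum>v\<in>U. \<Sum>e\<in>D. if v \<in> inc e then 1 else 0)"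
    using fin by (simp add: sum.If_cases Int_def)
  also have "\<dots> = (\<Sum>e\<in>D. \<Sum>v\<in>U. if v \<in> inc e then 1 else 0)"
    by (rule sum.swap)
  also have "\<dots> = (\<Sum>e\<in>D. card (inc e \<inter> U))"
    using fin by (simp add: sum.If_cases Int_def conj_commute)
  finally have eq: "(\<Sum>v\<in>U. card {e \<in> D. v \<in> inc e}) = (\<Sum>e\<in>D. card (inc e \<inter> U))" .
  have "odd (card (inc e \<inter> U)) \<longleftrightarrow> e \<in> cut U" if "e \<in> D" for e
  proof -
    have "e \<in> E" using that assms by blast
    then have "card (inc e \<inter> U) \<le> 2"
      using card_inc[of e] by (metis Int_lower1 card.infinite card_mono zero_neq_numeral)
    then have "odd (card (inc e \<inter> U)) \<longleftrightarrow> card (inc e \<inter> U) = 1"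
      by presburger
    then show ?thesis
      using \<open>e \<in> E\<close> by (simp add: cut_def)
  qed
  then have "{e \<in> D. odd (card (inc e \<inter> U))} = D \<inter> cut U"
    by blast
  moreover have "odd (card {v \<in> U. bd D v}) \<longleftrightarrow> odd (\<Sum>v\<in>U. card {e \<in> D. v \<in> inc e})"
    unfolding even_sum_iff[OF fin(1)] bd_def ..
  moreover have "odd (card {e \<in> D. odd (card (inc e \<inter> U))}) \<longleftrightarrow> odd (\<Sum>e\<in>D. card (inc e \<inter> U))"
    unfolding even_sum_iff[OF fin(2)] ..
  ultimately show ?thesis
    by (simp only: eq)
qed

lemma sum_degrees:
  assumes "D \<subseteq> E"
  shows "(\<Sum>v\<in>V. card {e \<in> D. v \<in> inc e}) = 2 * card D"
proof (rule sum_multicount)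
  show "\<forall>e\<in>D. card {v \<in> V. v \<in> inc e} = 2"
  proof
    fix e assume "e \<in> D"
    then have "{v \<in> V. v \<in> inc e} = inc e" "card (inc e) = 2"
      using assms inc_subset card_inc by blast+
    then show "card {v \<in> V. v \<in> inc e} = 2" by simp
  qed
qed (use assms finite_V finite_sub in auto)

lemma reach_refl: "b \<in> reach D b"
proof -
  have "{} \<subseteq> D \<and> (\<forall>x. bd {} x = ((x = b) \<noteq> (x = b)))"
    by simp
  then show ?thesis
    unfolding reach_def by blast
qed

lemma reach_step:
  assumes "D \<subseteq> E" "e \<in> D" "u \<in> inc e" "v \<in> inc e" "u \<in> reach D b"
  shows "v \<in> reach D b"
proof (cases "u = v")
  case False
  then have inc: "inc e = {u, v}"
  proof -
    have "card (inc e) = 2" using assms card_inc by blast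
    then show ?thesis using assms False by (auto simp: card_2_iff)
  qed
  obtain Q where Q: "Q \<subseteq> D" "\<And>x. bd Q x = ((x = b) \<noteq> (x = u))"
    using assms by (auto simp: reach_def)
  have "bd (sym_diff Q {e}) x = ((x = b) \<noteq> (x = v))" for x
    using Q assms inc False by (subst bd_sym_diff) auto
  moreover have "sym_diff Q {e} \<subseteq> D"
    using Q assms by auto
  ultimately show ?thesis
    unfolding reach_def by blast
qed (use assms in simp)

lemma reach_in_V:
  assumes "D \<subseteq> E" "b \<in> V"
  shows "reach D b \<subseteq> V"
proof
  fix v assume "v \<in> reach D b"
  then obtain Q where Q: "Q \<subseteq> D" "\<And>x. bd Q x = ((x = b) \<noteq> (x = v))"
    by (auto simp: reach_def)
  then show "v \<in> V"
    using assms bd_in_V[of Q v] by (cases "v = b") auto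
qed

lemma reach_cut:
  assumes "D \<subseteq> E" "D \<inter> cut U = {}"
  shows "D \<inter> cut (reach D b - U) = {}"
proof -
  have False if e: "e \<in> D" "e \<in> cut (reach D b - U)" for e
  proof -
    obtain x y where xy: "inc e = {x, y}" "x \<in> reach D b - U" "y \<notin> reach D b - U"
      using cut_endpoints[OF e(2)] .
    then show False
      using reach_step[of D e x y b] not_cut_iff[of e U x y] assms e by auto
  qed
  then show ?thesis by blast
qed

text \<open>Supplies the exchange set of \<open>cut_exchange\<close>. If no two cut edges of
  \<open>D\<close> were linked outside \<open>U\<close>, the component outside \<open>U\<close> of
  the outer end \<open>b\<close> of one of them would meet no further cut edge. If it also missed
  \<open>s\<close>, then \<open>b\<close> would be its only odd vertex with respect to
  \<open>D - cut U\<close>, against \<open>handshake\<close>. So all outer ends reach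
  \<open>s\<close>, and hence each other.\<close>

lemma linked_cut_edges:
  assumes D: "D \<subseteq> E" and U: "U \<subseteq> V" and s: "s \<notin> U"
    and bdD: "\<And>v. v \<notin> U \<Longrightarrow> bd D v = (v = s)"
    and two: "card (D \<inter> cut U) \<ge> 2"
  obtains e1 e2 b1 b2 Q where "e1 \<in> D \<inter> cut U" "e2 \<in> D \<inter> cut U" "e1 \<noteq> e2"
    "b1 \<in> inc e1 - U" "b2 \<in> inc e2 - U" "Q \<subseteq> D - cut U"
    "\<And>x. bd Q x = ((x = b1) \<noteq> (x = b2))"
proof (rule ccontr)
  assume neg: "\<not> thesis"
  let ?D0 = "D - cut U"
  note found = that
  have none: False if h: "e \<in> D \<inter> cut U" "f \<in> D \<inter> cut U" "e \<noteq> f" "b \<in> inc e - U" "c \<in> inc f - U"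
    "c \<in> reach ?D0 b" for e f b c
  proof -
    obtain Q where "Q \<subseteq> ?D0" "\<And>x. bd Q x = ((x = b) \<noteq> (x = c))"
      using h(6) by (auto simp: reach_def)
    then show False
      using found[OF h(1-5)] neg by blast
  qed
  have D0: "?D0 \<subseteq> E" "?D0 \<inter> cut U = {}"
    using D by auto
  have key: "s \<in> reach ?D0 b" if e: "e \<in> D \<inter> cut U" and b: "b \<in> inc e - U" for e b
  proof (rule ccontr)
    assume s': "s \<notin> reach ?D0 b"
    define C where "C = reach ?D0 b - U"
    have "b \<in> V"
      using e b D inc_subset by blast
    then have C: "C \<subseteq> V"
      using reach_in_V[OF D0(1)] by (auto simp: C_def)
    have ev: "even (card {v \<in> C. bd ?D0 v})"
      using handshake[OF D0(1) C] reach_cut[OF D0] by (simp add: C_def)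
    have bd0: "bd ?D0 v \<longleftrightarrow> odd (card {f \<in> D \<inter> cut U. v \<in> inc f})" if "v \<in> C" for v
    proof -
      have "?D0 = sym_diff D (D \<inter> cut U)" by auto
      then have "bd ?D0 v \<longleftrightarrow> bd D v \<noteq> bd (D \<inter> cut U) v"
        using bd_sym_diff[of D "D \<inter> cut U" v] D by auto
      moreover have "\<not> bd D v"
        using bdD[of v] that s' by (auto simp: C_def)
      ultimately show ?thesis by (simp add: bd_def)
    qed
    obtain c where c: "inc e - U = {c}"
      using cut_outside[of e U] e by blast
    have inc_e: "inc e - U = {b}"
      using b unfolding c by simp
    have set: "{f \<in> D \<inter> cut U. v \<in> inc f} = (if v = b then {e} else {})" if "v \<in> C" for v
    proof -
      have v: "v \<in> reach ?D0 b" "v \<notin> U"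
        using that by (auto simp: C_def)
      have "f = e \<and> v = b" if f: "f \<in> D \<inter> cut U" "v \<in> inc f" for f
      proof -
        have "v \<in> inc f - U" using v f by simp
        then have "e = f" using none[OF e f(1) _ b _ v(1)] by blast
        then show ?thesis using inc_e \<open>v \<in> inc f - U\<close> by simp
      qed
      moreover have "b \<in> inc e" using b by simp
      ultimately have "f \<in> D \<inter> cut U \<and> v \<in> inc f \<longleftrightarrow> f = e \<and> v = b" for f
        using e by blast
      then show ?thesis by simp
    qed
    have "b \<in> C" using b reach_refl by (auto simp: C_def)
    moreover have "bd ?D0 v \<longleftrightarrow> v = b" if "v \<in> C" for v
      unfolding bd0[OF that] set[OF that] by simp
    ultimately have "{v \<in> C. bd ?D0 v} = {b}"
      by blast
    then show False using ev by simp
  qed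
  have "finite (D \<inter> cut U)" "\<not> card (D \<inter> cut U) \<le> Suc 0"
    using finite_sub[OF D] two by auto
  then have "\<not> (\<forall>e1\<in>D \<inter> cut U. \<forall>e2\<in>D \<inter> cut U. e1 = e2)"
    using card_le_Suc0_iff_eq by blast
  then obtain e1 e2 where e12: "e1 \<in> D \<inter> cut U" "e2 \<in> D \<inter> cut U" "e1 \<noteq> e2"
    by blast
  obtain b1 where b1: "b1 \<in> inc e1 - U"
    using cut_outside[of e1 U] e12(1) by auto
  obtain b2 where b2: "b2 \<in> inc e2 - U"
    using cut_outside[of e2 U] e12(2) by auto
  note b12 = b1 b2
  obtain Q1 where Q1: "Q1 \<subseteq> ?D0" "\<And>x. bd Q1 x = ((x = b1) \<noteq> (x = s))"
    using key[OF e12(1) b12(1)] by (auto simp: reach_def)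
  obtain Q2 where Q2: "Q2 \<subseteq> ?D0" "\<And>x. bd Q2 x = ((x = b2) \<noteq> (x = s))"
    using key[OF e12(2) b12(2)] by (auto simp: reach_def)
  have "Q1 \<subseteq> E" "Q2 \<subseteq> E"
    using Q1(1) Q2(1) D by blast+
  then have "bd (sym_diff Q1 Q2) x = ((x = b1) \<noteq> (x = b2))" for x
    by (simp only: bd_sym_diff Q1(2) Q2(2)) blast
  moreover have "sym_diff Q1 Q2 \<subseteq> ?D0"
    using Q1 Q2 by blast
  ultimately have "b2 \<in> reach ?D0 b1"
    unfolding reach_def by blast
  then show False
    using none[OF e12 b12] by blast
qed

section \<open>T-joins and exchanges across a cut\<close>

definition join :: "('v \<Rightarrow> bool) \<Rightarrow> 'e set \<Rightarrow> bool" where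
  "join T J \<longleftrightarrow> J \<subseteq> E \<and> (\<forall>v. bd J v = T v)"

lemma join_sym_diff:
  assumes "join S A" "join T B"
  shows "join (\<lambda>x. S x \<noteq> T x) (sym_diff A B)"
  using assms bd_sym_diff by (auto simp: join_def)

lemma join_cong: "join S A \<Longrightarrow> (\<And>x. S x = T x) \<Longrightarrow> join T A"
  by (simp add: join_def)

lemma join_edge:
  assumes "e \<in> E" "inc e = {a, b}"
  shows "join (\<lambda>x. (x = a) \<noteq> (x = b)) {e}"
proof -
  have "a \<noteq> b"
    using card_inc[OF assms(1)] assms(2) by auto
  then show ?thesis
    using assms by (auto simp: join_def)
qed

lemma sum_sym_diff_zero:
  fixes w :: "'e \<Rightarrow> nat"
  assumes "A \<subseteq> E" "Z \<subseteq> E" "sum w Z = 0"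
  shows "sum w (sym_diff A Z) = sum w A"
proof -
  have "sum w (A \<inter> Z) \<le> sum w Z"
    using assms finite_sub by (intro sum_mono2) auto
  then show ?thesis
    using sum_sym_diff_nat[of A Z w] assms finite_sub by simp
qed

text \<open>Each edge of \<open>R\<close> lies in exactly one of \<open>J\<close> and
  \<open>K\<close> and moves to the other.\<close>

lemma sum_exchange:
  fixes w :: "'e \<Rightarrow> nat"
  assumes "J \<subseteq> E" "K \<subseteq> E" "R \<subseteq> sym_diff J K"
  shows "sum w (sym_diff J R) + sum w (sym_diff K R) = sum w J + sum w K"
proof -
  have "finite J" "finite K"
    using assms finite_sub by auto
  then have fin: "finite J" "finite K" "finite R"
    using finite_subset[OF assms(3)] by auto
  have "sum w R = sum w (J \<inter> R) + sum w (K \<inter> R)"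
  proof -
    have "R = (J \<inter> R) \<union> (K \<inter> R)" "(J \<inter> R) \<inter> (K \<inter> R) = {}"
      using assms(3) by blast+
    then show ?thesis
      using fin sum.union_disjoint[of "J \<inter> R" "K \<inter> R" w] by simp
  qed
  then show ?thesis
    using sum_sym_diff_nat[OF fin(1,3), of w] sum_sym_diff_nat[OF fin(2,3), of w] by simp
qed

text \<open>Two cut edges of \<open>J\<close> that are linked outside \<open>U\<close> in \<open>J \<triangle> K\<close> yield a set \<open>R\<close>, closed up to edges of
  weight zero, that can be exchanged between \<open>J\<close> and \<open>K\<close>. Minimality of \<open>K\<close>, applied to \<open>K \<triangle> R\<close> without
  one of the two edges, shows that \<open>J \<triangle> R\<close> is lighter than \<open>J\<close>, and by parity lighter by two.\<close>

lemma cut_exchange: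
  fixes w :: "'e \<Rightarrow> nat"
  assumes even: "\<And>C. join (\<lambda>_. False) C \<Longrightarrow> even (sum w C)"
    and U: "U \<subseteq> V" "s \<notin> U" "t \<in> U"
    and pos: "\<And>e. e \<in> cut U \<Longrightarrow> w e > 0"
    and zero: "\<And>u. u \<in> U \<Longrightarrow> \<exists>Z. join (\<lambda>x. (x = u) \<noteq> (x = t)) Z \<and> sum w Z = 0"
    and K: "join (\<lambda>x. T x \<noteq> ((x = s) \<noteq> (x = t))) K" "K \<inter> cut U = {}"
    and Kmin: "\<And>v L. join (\<lambda>x. T x \<noteq> ((x = s) \<noteq> (x = v))) L \<Longrightarrow> sum w K \<le> sum w L"
    and J: "join T J"
  shows "\<exists>J'. join T J' \<and> sum w J' + card (J \<inter> cut U) \<le> sum w J + 1"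
  using J
proof (induction "card (J \<inter> cut U)" arbitrary: J rule: less_induct)
  case less
  show ?case
  proof (cases "card (J \<inter> cut U) \<le> 1")
    \<comment> \<open>The slack 1 in the bound pays for one remaining crossing; each exchange below
      removes two.\<close>
    case True
    then show ?thesis using less.prems by (intro exI[of _ J]) simp
  next
    case False
    define D where "D = sym_diff J K"
    have sub: "J \<subseteq> E" "K \<subseteq> E" "D \<subseteq> E"
      using less.prems K by (auto simp: join_def D_def)
    have Dcut: "D \<inter> cut U = J \<inter> cut U"
      using K(2) by (auto simp: D_def)
    have bdD: "bd D v = (v = s)" if "v \<notin> U" for v
    proof -
      have "join (\<lambda>x. (x = s) \<noteq> (x = t)) D"
        unfolding D_def by (rule join_cong[OF join_sym_diff[OF less.prems K(1)]]) blast
      then show ?thesis using that U by (auto simp: join_def)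
    qed
    have two: "card (D \<inter> cut U) \<ge> 2"
      using False Dcut by simp
    obtain e1 e2 b1 b2 Q where e: "e1 \<in> D \<inter> cut U" "e2 \<in> D \<inter> cut U" "e1 \<noteq> e2"
      and b: "b1 \<in> inc e1 - U" "b2 \<in> inc e2 - U" and Q: "Q \<subseteq> D - cut U"
      "\<And>x. bd Q x = ((x = b1) \<noteq> (x = b2))"
      by (rule linked_cut_edges[OF sub(3) U(1) U(2) bdD two]) blast+
    have eE: "e1 \<in> E" "e2 \<in> E"
      using e sub by auto
    obtain a1 where a1: "inc e1 = {a1, b1}" "a1 \<in> U"
      using e(1) b(1) by (metis Diff_iff IntD2 cut_endpoints insertE singletonD)
    obtain a2 where a2: "inc e2 = {a2, b2}" "a2 \<in> U"
      using e(2) b(2) by (metis Diff_iff IntD2 cut_endpoints insertE singletonD)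
    define R where "R = sym_diff (sym_diff Q {e1}) {e2}"
    have R: "R = Q \<union> {e1, e2}"
      using e Q(1) by (auto simp: R_def)
    have RD: "R \<subseteq> D"
      using R e Q by auto
    have Rcut: "R \<inter> cut U = {e1, e2}"
      using R e Q by auto
    have joinQ: "join (\<lambda>x. (x = b1) \<noteq> (x = b2)) Q"
      using Q sub by (auto simp: join_def)
    have joinR: "join (\<lambda>x. (x = a1) \<noteq> (x = a2)) R"
      unfolding R_def
      by (rule join_cong[OF join_sym_diff[OF join_sym_diff[OF joinQ join_edge[OF eE(1) a1(1)]]
            join_edge[OF eE(2) a2(1)]]]) blast
    obtain Z1 where Z1: "join (\<lambda>x. (x = a1) \<noteq> (x = t)) Z1" "sum w Z1 = 0"
      using zero[OF a1(2)] by blast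
    obtain Z2 where Z2: "join (\<lambda>x. (x = a2) \<noteq> (x = t)) Z2" "sum w Z2 = 0"
      using zero[OF a2(2)] by blast
    have Zsub: "Z1 \<subseteq> E" "Z2 \<subseteq> E" "R \<subseteq> E"
      using Z1 Z2 RD sub by (auto simp: join_def)
    have Zcut: "Z \<inter> cut U = {}" if "Z \<subseteq> E" "sum w Z = 0" for Z
    proof -
      have "w f = 0" if "f \<in> Z" for f
        using that \<open>sum w Z = 0\<close> finite_sub[OF \<open>Z \<subseteq> E\<close>] by simp
      then show ?thesis using pos by fastforce
    qed

    \<comment> \<open>Dropping \<open>e1\<close> moves the odd vertex \<open>a1\<close> to
      \<open>b1\<close>, and \<open>Z2\<close> cancels \<open>a2\<close> against \<open>t\<close> at
      no cost. The result competes with \<open>K\<close>, with \<open>b1\<close> in the role of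
      \<open>t\<close>.\<close>
    define L where "L = sym_diff (sym_diff K R) {e1}"
    have "join (\<lambda>x. T x \<noteq> ((x = s) \<noteq> (x = b1))) (sym_diff L Z2)"
      unfolding L_def
      by (rule join_cong[OF join_sym_diff[OF join_sym_diff[OF join_sym_diff[OF K(1) joinR]
            join_edge[OF eE(1) a1(1)]] Z2(1)]]) blast
    then have "sum w K \<le> sum w (sym_diff L Z2)"
      by (rule Kmin)
    also have "\<dots> = sum w L"
      using sub Zsub eE Z2(2) by (intro sum_sym_diff_zero) (auto simp: L_def)
    finally have "sum w K \<le> sum w L" .
    moreover have "sum w (sym_diff K R) = w e1 + sum w L"
    proof -
      have "e1 \<in> sym_diff K R"
        using R K(2) e by auto
      moreover from this have "L = sym_diff K R - {e1}"
        by (auto simp: L_def)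
      moreover have "finite (sym_diff K R)"
        using sub Zsub finite_sub by auto
      ultimately show ?thesis
        by (metis sum.remove)
    qed
    ultimately have "sum w K < sum w (sym_diff K R)"
      using pos[of e1] e by simp
    then have less_J: "sum w (sym_diff J R) < sum w J"
      using sum_exchange[OF sub(1,2), of R w] RD by (simp add: D_def)

    \<comment> \<open>\<open>R\<close> spoils the boundary only at \<open>a1\<close> and
      \<open>a2\<close>. The sets \<open>Z1\<close> and \<open>Z2\<close> link both to
      \<open>t\<close>; having weight 0 they avoid \<open>cut U\<close>, so neither weight nor
      crossings change.\<close>
    define J1 where "J1 = sym_diff (sym_diff (sym_diff J R) Z1) Z2"
    have J1: "join T J1"
      unfolding J1_def
      by (rule join_cong[OF join_sym_diff[OF join_sym_diff[OF join_sym_diff[OF less.prems joinR]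
            Z1(1)] Z2(1)]]) blast
    have "sum w J1 = sum w (sym_diff (sym_diff J R) Z1)"
      unfolding J1_def using sub Zsub Z2(2) by (intro sum_sym_diff_zero) auto
    also have "\<dots> = sum w (sym_diff J R)"
      using sub Zsub Z1(2) by (intro sum_sym_diff_zero) auto
    finally have lt: "sum w J1 < sum w J"
      using less_J by simp
    have "join (\<lambda>_. False) (sym_diff J1 J)"
      by (rule join_cong[OF join_sym_diff[OF J1 less.prems]]) blast
    then have "even (sum w (sym_diff J1 J))"
      by (rule even)
    moreover have "J1 \<subseteq> E" using J1 by (simp add: join_def)
    ultimately have "even (sum w J1 + sum w J)"
      using sum_sym_diff_nat[of J1 J w] finite_sub sub by (metis dvd_triv_left even_add)
    moreover have "m + 2 \<le> n" if "m < n" "even (m + n)" for m n :: nat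
      using that by presburger
    ultimately have lt2: "sum w J1 + 2 \<le> sum w J"
      using lt by blast
    have e12J: "e1 \<in> J \<inter> cut U" "e2 \<in> J \<inter> cut U"
      using e(1,2) unfolding Dcut .
    have J1cut: "J1 \<inter> cut U = J \<inter> cut U - {e1, e2}"
      
    proof -
      have "f \<in> R \<longleftrightarrow> f = e1 \<or> f = e2" "f \<notin> Z1" "f \<notin> Z2" if "f \<in> cut U" for f
        using that Rcut Zcut[OF Zsub(1) Z1(2)] Zcut[OF Zsub(2) Z2(2)] by blast+
      then show ?thesis
        using e12J unfolding J1_def by blast
    qed
    have "card (J \<inter> cut U) = card (J \<inter> cut U - {e1, e2}) + 2"
    proof -
      have "finite (J \<inter> cut U)" using sub finite_sub by blast
      then have "card (J \<inter> cut U - {e1, e2}) = card (J \<inter> cut U) - card {e1, e2}"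
        using e12J by (intro card_Diff_subset) auto
      then show ?thesis using False e(3) by simp
    qed
    then have card: "card (J \<inter> cut U) = card (J1 \<inter> cut U) + 2"
      by (simp only: J1cut)
    then obtain J' where "join T J'" "sum w J' + card (J1 \<inter> cut U) \<le> sum w J1 + 1"
      using less.hyps[of J1] J1 by auto
    then show ?thesis
      using lt2 card by (intro exI[of _ J']) simp
  qed
qed

text \<open>Reducing the weights on a suitable cut by one reduces the minimum weight of a join by at most one,
  but the total weight by at least three.\<close>

theorem light_join_of_even_weight:
  fixes w :: "'e \<Rightarrow> nat"
  assumes odd_cut: "\<And>U. U \<subseteq> V \<Longrightarrow> odd (card {v \<in> U. T v}) \<Longrightarrow> 3 \<le> card (cut U)"
    and ex: "join T J0"
    and even: "\<And>C. join (\<lambda>_. False) C \<Longrightarrow> even (sum w C)"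
  shows "\<exists>J. join T J \<and> 3 * sum w J \<le> sum w E"
  using even
proof (induction "sum w E" arbitrary: w rule: less_induct)
  case less
  obtain J where J: "join T J" and Jmin: "\<And>L. join T L \<Longrightarrow> sum w J \<le> sum w L"
    using ex_has_least_nat[of "join T" J0 "sum w"] ex by blast
  show ?case
  proof (cases "sum w J = 0")
    case True
    then show ?thesis using J by auto
  next
    case False
    then obtain e where e: "e \<in> J" "w e > 0"
      by (metis gr0I sum.neutral)
    have JE: "J \<subseteq> E" and eE: "e \<in> E"
      using J e by (auto simp: join_def)
    obtain s b where sb: "inc e = {s, b}"
      using card_inc[OF eE] by (auto simp: card_2_iff)
    have remove: "sum w (sym_diff A {f}) < sum w A" if "f \<in> A" "w f > 0" "A \<subseteq> E" for A f
    proof -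
      have "sym_diff A {f} = A - {f}" using that by auto
      then show ?thesis
        using that finite_sub[of A] sum.remove[of A f w] by simp
    qed
    \<comment> \<open>The minimum is taken over \<open>t\<close> as well as over the join. This
      freedom later forces \<open>K\<close> to avoid the cut around \<open>t\<close>.\<close>
    let ?P = "\<lambda>(t, L). join (\<lambda>x. T x \<noteq> ((x = s) \<noteq> (x = t))) L"
    have "?P (b, sym_diff J {e})"
      using join_sym_diff[OF J join_edge[OF eE sb]] by simp
    then obtain p where p: "?P p" "\<And>q. ?P q \<Longrightarrow> sum w (snd p) \<le> sum w (snd q)"
      using ex_has_least_nat[of ?P _ "\<lambda>q. sum w (snd q)"] by blast
    obtain t K where tK: "p = (t, K)" by fastforce
    have K: "join (\<lambda>x. T x \<noteq> ((x = s) \<noteq> (x = t))) K"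
      using p(1) tK by simp
    have Kmin: "sum w K \<le> sum w L" if "join (\<lambda>x. T x \<noteq> ((x = s) \<noteq> (x = v))) L" for v L
      using p(2)[of "(v, L)"] that tK by simp
    have "sum w K \<le> sum w (sym_diff J {e})"
      using p(2)[OF \<open>?P (b, sym_diff J {e})\<close>] tK by simp
    then have KJ: "sum w K < sum w J"
      using remove[OF e JE] by simp
    have KE: "K \<subseteq> E" using K by (simp add: join_def)
    \<comment> \<open>The component of \<open>t\<close> in the graph of weight-0 edges; every edge
      leaving it has positive weight and can be lowered. It misses \<open>s\<close>, since otherwise
      \<open>K\<close> could be completed to a \<open>T\<close>-join lighter than
      \<open>J\<close>.\<close>
    define U where "U = {u. \<exists>Z. join (\<lambda>x. (x = u) \<noteq> (x = t)) Z \<and> sum w Z = 0}"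
    have tU: "t \<in> U"
      unfolding U_def by (auto simp: join_def intro!: exI[of _ "{}"])
    have sU: "s \<notin> U"
    proof
      assume "s \<in> U"
      then obtain Z where Z: "join (\<lambda>x. (x = s) \<noteq> (x = t)) Z" "sum w Z = 0"
        by (auto simp: U_def)
      have "join T (sym_diff K Z)"
        by (rule join_cong[OF join_sym_diff[OF K Z(1)]]) blast
      moreover have "sum w (sym_diff K Z) = sum w K"
        using Z KE by (intro sum_sym_diff_zero) (auto simp: join_def)
      ultimately show False using Jmin KJ by fastforce
    qed
    \<comment> \<open>The boundaries of \<open>J\<close> and \<open>K\<close> differ at
      \<open>t\<close>, so one of the two sets has an edge there.\<close>
    have tV: "t \<in> V"
    proof -
      have "s \<noteq> t" using sU tU by auto
      then have "bd K t \<or> bd J t"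
        using K J by (auto simp: join_def)
      then show ?thesis using bd_in_V JE KE by blast
    qed
    have UV: "U \<subseteq> V"
    proof
      fix u assume "u \<in> U"
      then obtain Z where Z: "join (\<lambda>x. (x = u) \<noteq> (x = t)) Z"
        by (auto simp: U_def)
      show "u \<in> V"
        using Z bd_in_V[of Z u] tV by (cases "u = t") (auto simp: join_def)
    qed
    have pos: "w f > 0" if f: "f \<in> cut U" for f
    proof (rule ccontr)
      assume "\<not> w f > 0"
      then have w0: "sum w {f} = 0" by simp
      have fE: "f \<in> E" using f by (simp add: cut_def)
      obtain x y where xy: "inc f = {x, y}" "x \<in> U" "y \<notin> U"
        using cut_endpoints[OF f] .
      then obtain Z where Z: "join (\<lambda>v. (v = x) \<noteq> (v = t)) Z" "sum w Z = 0"
        by (auto simp: U_def)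
      have "join (\<lambda>v. (v = y) \<noteq> (v = t)) (sym_diff Z {f})"
        by (rule join_cong[OF join_sym_diff[OF Z(1) join_edge[OF fE xy(1)]]]) blast
      moreover have "sum w (sym_diff Z {f}) = sum w Z"
        using Z fE w0 by (intro sum_sym_diff_zero) (auto simp: join_def)
      ultimately show False using xy(3) Z(2) by (auto simp: U_def)
    qed
    \<comment> \<open>An edge of \<open>K\<close> in the cut could be deleted: a weight-0 link
      repairs the inner end, and the outer end takes over the role of \<open>t\<close>, giving a
      lighter competitor.\<close>
    have Kcut: "K \<inter> cut U = {}"
    proof (rule ccontr)
      assume "K \<inter> cut U \<noteq> {}"
      then obtain f where f: "f \<in> K" "f \<in> cut U" by blast
      have fE: "f \<in> E" using f by (simp add: cut_def)
      obtain x y where xy: "inc f = {x, y}" "x \<in> U" "y \<notin> U"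
        using cut_endpoints[OF f(2)] .
      then obtain Z where Z: "join (\<lambda>v. (v = x) \<noteq> (v = t)) Z" "sum w Z = 0"
        by (auto simp: U_def)
      have "join (\<lambda>v. T v \<noteq> ((v = s) \<noteq> (v = y))) (sym_diff (sym_diff K {f}) Z)"
        by (rule join_cong[OF join_sym_diff[OF join_sym_diff[OF K join_edge[OF fE xy(1)]] Z(1)]]) blast
      then have "sum w K \<le> sum w (sym_diff (sym_diff K {f}) Z)"
        by (rule Kmin)
      also have "\<dots> = sum w (sym_diff K {f})"
        using Z KE fE by (intro sum_sym_diff_zero) (auto simp: join_def)
      finally show False
        using remove[OF f(1) pos[OF f(2)] KE] by simp
    qed
    \<comment> \<open>\<open>K\<close> does not cross the cut, so its boundary is even on
      \<open>U\<close>, where it differs from \<open>T\<close> exactly at \<open>t\<close>.\<close>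
    have odd_U: "odd (card {v \<in> U. T v})"
    proof -
      have fin: "finite U" using UV finite_V finite_subset by blast
      have "bd K v \<longleftrightarrow> (T v \<noteq> (v = t))" if "v \<in> U" for v
        using K that sU by (auto simp: join_def)
      then have "{v \<in> U. bd K v} = sym_diff {v \<in> U. T v} {t}"
        using tU by auto
      moreover have "even (card {v \<in> U. bd K v})"
        using handshake[OF KE UV] Kcut by simp
      ultimately show ?thesis
        using odd_card_sym_diff[of "{v \<in> U. T v}" "{t}"] fin by simp
    qed
    have cut3: "3 \<le> card (cut U)"
      by (rule odd_cut[OF UV odd_U])
    have cutE: "cut U \<subseteq> E" by (auto simp: cut_def)
    \<comment> \<open>The truncated subtraction is exact because cut edges have positive weight.
      Sets with zero boundary cross the cut evenly, so their weights stay even.\<close>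
    define w' where "w' f = (if f \<in> cut U then w f - 1 else w f)" for f
    have w': "sum w D = sum w' D + card (D \<inter> cut U)" if "D \<subseteq> E" for D
    proof -
      have fin: "finite D" using that finite_sub by blast
      have "sum w D = (\<Sum>f\<in>D. w' f + (if f \<in> cut U then 1 else 0))"
        by (rule sum.cong) (use pos in \<open>auto simp: w'_def Suc_le_eq\<close>)
      also have "\<dots> = sum w' D + card (D \<inter> cut U)"
        using fin by (simp add: sum.distrib sum.If_cases Int_def)
      finally show ?thesis .
    qed
    have wE: "sum w E = sum w' E + card (cut U)"
      using w'[of E] cutE by (simp add: Int_absorb1)
    have "even (sum w' C)" if C: "join (\<lambda>_. False) C" for C
    proof -
      have CE: "C \<subseteq> E" and "{v \<in> U. bd C v} = {}"
        using C by (auto simp: join_def)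
      then have "even (card (C \<inter> cut U))"
        using handshake[OF CE UV] by (simp only: card.empty even_zero) blast
      then show ?thesis
        using w'[OF CE] less.prems[OF C] by simp
    qed
    then obtain J1 where J1: "join T J1" "3 * sum w' J1 \<le> sum w' E"
      using less.hyps[of w'] wE cut3 by auto
    have zero: "\<exists>Z. join (\<lambda>x. (x = u) \<noteq> (x = t)) Z \<and> sum w Z = 0" if "u \<in> U" for u
      using that by (simp add: U_def)
    have "\<exists>J2. join T J2 \<and> sum w J2 + card (J1 \<inter> cut U) \<le> sum w J1 + 1"
      by (rule cut_exchange[OF _ UV sU tU _ _ K Kcut _ J1(1)]) (fact less.prems pos zero Kmin)+
    then obtain J2 where J2: "join T J2" "sum w J2 + card (J1 \<inter> cut U) \<le> sum w J1 + 1"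
      by blast
    \<comment> \<open>Now \<open>sum w J2\<close> is at most \<open>sum w' J1 + 1\<close>, and
      tripling costs 3, which the three or more edges of the cut cover.\<close>
    have "J1 \<subseteq> E" using J1 by (simp add: join_def)
    then have "3 * sum w J2 \<le> sum w E"
      using J2(2) J1(2) w'[of J1] wE cut3 by simp
    then show ?thesis using J2(1) by blast
  qed
qed

text \<open>Doubling the weights makes the parity condition automatic, and the inequality is
  homogeneous.\<close>

theorem light_join:
  fixes w :: "'e \<Rightarrow> nat"
  assumes "\<And>U. U \<subseteq> V \<Longrightarrow> odd (card {v \<in> U. T v}) \<Longrightarrow> 3 \<le> card (cut U)"
    and "join T J0"
  shows "\<exists>J. join T J \<and> 3 * sum w J \<le> sum w E"
proof -
  have "\<exists>J. join T J \<and> 3 * (\<Sum>e\<in>J. 2 * w e) \<le> (\<Sum>e\<in>E. 2 * w e)"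
    by (rule light_join_of_even_weight[OF assms]) (auto simp: sum_distrib_left[symmetric])
  then show ?thesis
    by (simp add: sum_distrib_left[symmetric])
qed

end

section \<open>Cycles and faces of plane graphs\<close>

fun walk_edges :: "'a list \<Rightarrow> 'a set set" where
  "walk_edges (a # b # xs) = insert {a, b} (walk_edges (b # xs))"
| "walk_edges _ = {}"

lemma walk_edges_subset: "e \<in> walk_edges xs \<Longrightarrow> e \<subseteq> set xs"
  by (induction xs rule: walk_edges.induct) auto

lemma walk_edges_suffix: "walk_edges ys \<subseteq> walk_edges (xs @ ys)"
proof (induction xs)
  case (Cons a xs)
  then show ?case by (cases "xs @ ys") auto
qed simp

lemma finite_walk_edges: "finite (walk_edges xs)"
  by (induction xs rule: walk_edges.induct) auto

text \<open>The inverse of the arc would embed a nonempty open set of the plane into the real line,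
  against invariance of dimension.\<close>

lemma empty_interior_arc:
  fixes g :: "real \<Rightarrow> complex"
  assumes "arc g"
  shows "interior (path_image g) = {}"
proof (rule ccontr)
  assume ne: "interior (path_image g) \<noteq> {}"
  obtain h where h: "homeomorphism {0..1} (path_image g) g h"
    using homeomorphism_arc[OF assms] .
  have sub: "interior (path_image g) \<subseteq> path_image g"
    by (rule interior_subset)
  have "continuous_on (interior (path_image g)) h"
    using h continuous_on_subset[OF _ sub] by (auto simp: homeomorphism_def)
  moreover have "inj_on h (interior (path_image g))"
    using h sub by (intro inj_on_inverseI[of _ g]) (auto simp: homeomorphism_def)
  ultimately have "DIM(complex) \<le> DIM(real)"
    using invariance_of_dimension[of "interior (path_image g)" h] ne by simp
  then show False by simp
qed

context plane_graph
begin

definition edge_interior :: "'v set \<Rightarrow> complex set" where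
  "edge_interior e = path_image (curve e) - pos ` e"

definition trace :: "'v set set \<Rightarrow> complex set" where
  "trace S = (\<Union>e\<in>S. path_image (curve e))"

text \<open>Only the union of the curves matters: it has to be a Jordan curve, so the Jordan theorem
  applies without any vertex sequence.\<close>

definition cycle :: "'v set set \<Rightarrow> bool" where
  "cycle S \<longleftrightarrow> S \<subseteq> E \<and>
    (\<exists>g. simple_path g \<and> pathfinish g = pathstart g \<and> path_image g = trace S)"

definition edges_of :: "complex set \<Rightarrow> 'v set set" where
  "edges_of F = {e \<in> E. path_image (curve e) \<subseteq> frontier F}"

lemma finite_edges: "finite E"
  by (rule finite_subset[of _ "Pow V"]) (use edge_subset finite_vertices in auto)

lemma compact_edge: "e \<in> E \<Longrightarrow> compact (path_image (curve e))"
  by (simp add: curve_arc compact_arc_image)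

lemma compact_drawing: "compact drawing"
  unfolding drawing_def
  by (intro compact_Un compact_UN finite_imp_compact finite_imageI finite_vertices finite_edges compact_edge)

lemma edge_ends: "e \<in> E \<Longrightarrow> v \<in> e \<Longrightarrow> pos v \<in> path_image (curve e)"
  using curve_ends[of e] pathstart_in_path_image[of "curve e"] pathfinish_in_path_image[of "curve e"]
  by (metis image_eqI insert_iff singletonD)

lemma trace_subset_drawing: "S \<subseteq> E \<Longrightarrow> trace S \<subseteq> drawing"
  by (auto simp: trace_def drawing_def)

lemma edge_interior_eq:
  "e \<in> E \<Longrightarrow> edge_interior e = path_image (curve e) - {pathstart (curve e), pathfinish (curve e)}"
  by (simp add: edge_interior_def curve_ends)

lemma connected_edge_interior: "e \<in> E \<Longrightarrow> connected (edge_interior e)"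
  by (simp add: edge_interior_eq connected_simple_path_endless arc_imp_simple_path curve_arc)

lemma edge_interior_nonempty: "e \<in> E \<Longrightarrow> edge_interior e \<noteq> {}"
  unfolding edge_interior_eq by (intro nonempty_simple_path_endless arc_imp_simple_path curve_arc)

lemma edge_interior_disjoint_edge:
  assumes "e \<in> E" "f \<in> E" "e \<noteq> f"
  shows "edge_interior e \<inter> path_image (curve f) = {}"
  using curves_meet[OF assms] by (auto simp: edge_interior_def)

lemma edge_interior_disjoint_vertices: "e \<in> E \<Longrightarrow> edge_interior e \<inter> pos ` V = {}"
  using curve_avoids by (auto simp: edge_interior_def)

lemma edge_interior_disjoint_trace:
  assumes "e \<in> E" "S \<subseteq> E" "e \<notin> S"
  shows "edge_interior e \<inter> trace S = {}"
  using edge_interior_disjoint_edge[OF assms(1)] assms by (fastforce simp: trace_def)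

lemma edge_arc:
  assumes "{a, b} \<in> E"
  obtains g where "arc g" "pathstart g = pos a" "pathfinish g = pos b"
    "path_image g = path_image (curve {a, b})"
proof -
  have "{pathstart (curve {a, b}), pathfinish (curve {a, b})} = {pos a, pos b}"
    using curve_ends[OF assms] by simp
  then consider "pathstart (curve {a, b}) = pos a" "pathfinish (curve {a, b}) = pos b"
    | "pathstart (curve {a, b}) = pos b" "pathfinish (curve {a, b}) = pos a"
    by (auto simp: doubleton_eq_iff)
  then show thesis
  proof cases
    case 1
    then show thesis using that[of "curve {a, b}"] curve_arc[OF assms] by blast
  next
    case 2
    then show thesis
      using that[of "reversepath (curve {a, b})"] curve_arc[OF assms] by (simp add: arc_reversepath)
  qed
qed

lemma walk_arc:
  assumes "distinct (a # b # xs)" "walk_edges (a # b # xs) \<subseteq> E"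
  shows "\<exists>g. arc g \<and> pathstart g = pos a \<and> pathfinish g = pos (last (b # xs)) \<and>
    path_image g = trace (walk_edges (a # b # xs))"
  using assms
proof (induction xs arbitrary: a b)
  case Nil
  then have "{a, b} \<in> E" by simp
  then obtain g where "arc g" "pathstart g = pos a" "pathfinish g = pos b"
    "path_image g = path_image (curve {a, b})"
    by (rule edge_arc)
  then show ?case
    by (auto simp: trace_def)
next
  case (Cons c xs)
  have "distinct (b # c # xs)" "walk_edges (b # c # xs) \<subseteq> E"
    using Cons.prems by auto
  from Cons.IH[OF this] obtain g where g: "arc g" "pathstart g = pos b"
    "pathfinish g = pos (last (c # xs))" "path_image g = trace (walk_edges (b # c # xs))"
    by blast
  have ab: "{a, b} \<in> E" using Cons.prems by simp
  obtain h where h: "arc h" "pathstart h = pos a" "pathfinish h = pos b"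
    "path_image h = path_image (curve {a, b})"
    using edge_arc[OF ab] .
  have "path_image h \<inter> path_image g \<subseteq> {pathstart g}"
  proof
    fix x assume x: "x \<in> path_image h \<inter> path_image g"
    then obtain e where e: "e \<in> walk_edges (b # c # xs)" "x \<in> path_image (curve e)"
      using g(4) by (auto simp: trace_def)
    have "a \<notin> e"
      using walk_edges_subset[OF e(1)] Cons.prems(1) by auto
    then have "e \<noteq> {a, b}" and sub: "{a, b} \<inter> e \<subseteq> {b}" by auto
    moreover have "e \<in> E" using e Cons.prems by auto
    ultimately have "x \<in> pos ` ({a, b} \<inter> e)"
      using curves_meet[OF ab, of e] x e(2) h(4) by auto
    then show "x \<in> {pathstart g}"
      using sub g(2) by auto
  qed
  then have "arc (h +++ g)"
    using arc_join[OF h(1) g(1)] g h by simp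
  moreover have "path_image (h +++ g) = trace (walk_edges (a # b # c # xs))"
    using g h by (simp add: path_image_join trace_def)
  ultimately show ?case
    using g h by (intro exI[of _ "h +++ g"]) auto
qed

text \<open>With at least three vertices the closing edge is not on the walk, so the two arcs meet
  only at their common ends and form a simple loop.\<close>

lemma walk_cycle:
  assumes dist: "distinct (a # b # c # xs)" and sub: "walk_edges (a # b # c # xs) \<subseteq> E"
    and close: "{last (c # xs), a} \<in> E"
  shows "cycle (insert {last (c # xs), a} (walk_edges (a # b # c # xs)))"
proof -
  let ?z = "last (c # xs)"
  obtain g where g: "arc g" "pathstart g = pos a" "pathfinish g = pos ?z"
    "path_image g = trace (walk_edges (a # b # c # xs))"
    using walk_arc[OF dist sub] by auto
  obtain h where h: "arc h" "pathstart h = pos ?z" "pathfinish h = pos a"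
    "path_image h = path_image (curve {?z, a})"
    using edge_arc[OF close] .
  have z: "?z \<in> set (c # xs)" by (rule last_in_set) simp
  have "path_image g \<inter> path_image h \<subseteq> {pathstart g, pathstart h}"
  proof
    fix x assume x: "x \<in> path_image g \<inter> path_image h"
    then obtain e where e: "e \<in> walk_edges (a # b # c # xs)" "x \<in> path_image (curve e)"
      using g(4) by (auto simp: trace_def)
    have "e \<noteq> {?z, a}"
    proof
      assume *: "e = {?z, a}"
      have "e = {a, b} \<or> e \<in> walk_edges (b # c # xs)"
        using e by simp
      then show False
      proof
        assume "e = {a, b}"
        then have "?z = b" using * dist z by (auto simp: doubleton_eq_iff)
        then show False using dist z by auto
      next
        assume "e \<in> walk_edges (b # c # xs)"
        then show False using walk_edges_subset[of e] * dist by fastforce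
      qed
    qed
    moreover have "e \<in> E" using e sub by auto
    ultimately have "x \<in> pos ` (e \<inter> {?z, a})"
      using curves_meet[OF _ close] x e(2) h(4) by blast
    then show "x \<in> {pathstart g, pathstart h}"
      using g(2) h(2) by auto
  qed
  then have "simple_path (g +++ h)"
    using simple_path_join_loop[OF g(1) h(1)] g h by simp
  moreover have "path_image (g +++ h) = trace (insert {?z, a} (walk_edges (a # b # c # xs)))"
    using g h by (auto simp add: path_image_join trace_def)
  moreover have "insert {?z, a} (walk_edges (a # b # c # xs)) \<subseteq> E"
    using sub close by blast
  ultimately show ?thesis
    unfolding cycle_def using g h by (intro conjI exI[of _ "g +++ h"]) simp_all
qed

lemma cycle_sides:
  assumes "cycle S" "D = inside (trace S) \<or> D = outside (trace S)"
  shows "open D" "connected D" "D \<noteq> {}" "frontier D = trace S" "D \<inter> trace S = {}"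
    "inside (trace S) \<inter> outside (trace S) = {}"
    "inside (trace S) \<union> outside (trace S) = - trace S"
proof -
  obtain g where g: "simple_path g" "pathfinish g = pathstart g" "path_image g = trace S"
    using assms(1) by (auto simp: cycle_def)
  note J = Jordan_inside_outside[OF g(1,2), unfolded g(3)]
  show "open D" "connected D" "D \<noteq> {}" "frontier D = trace S"
    "inside (trace S) \<inter> outside (trace S) = {}"
    "inside (trace S) \<union> outside (trace S) = - trace S"
    using J assms(2) by auto
  show "D \<inter> trace S = {}"
    using assms(2) inside_no_overlap outside_no_overlap by blast
qed

lemma in_one_side:
  assumes "cycle S" "connected X" "X \<inter> trace S = {}"
  shows "X \<subseteq> inside (trace S) \<or> X \<subseteq> outside (trace S)"
proof (rule ccontr)
  assume *: "\<not> ?thesis"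
  note i = cycle_sides[OF assms(1) disjI1[OF refl]] 
  note o = cycle_sides[OF assms(1) disjI2[OF refl]]
  have "X \<subseteq> inside (trace S) \<union> outside (trace S)"
    using i(7) assms(3) by auto
  moreover from this have "inside (trace S) \<inter> X \<noteq> {}" "outside (trace S) \<inter> X \<noteq> {}"
    using * by blast+
  ultimately show False
    using connectedD[OF assms(2) i(1) o(1)] i(6) by blast
qed

lemma face_props:
  assumes "F \<in> faces"
  shows "open F" "connected F" "F \<noteq> {}" "F \<inter> drawing = {}" "frontier F \<subseteq> drawing"
proof -
  have F: "F \<in> components (- drawing)" using assms by (simp add: faces_def)
  have closed: "closed drawing" by (rule compact_imp_closed[OF compact_drawing])
  show "open F" using open_components[OF _ F] closed by (simp add: open_Compl)
  show "connected F" by (rule in_components_connected[OF F])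
  show "F \<noteq> {}" by (rule in_components_nonempty[OF F])
  show "F \<inter> drawing = {}" using in_components_subset[OF F] by auto
  show "frontier F \<subseteq> drawing" by (rule frontier_of_components_closed_complement[OF closed F])
qed

lemma faces_disjoint: "F \<in> faces \<Longrightarrow> G \<in> faces \<Longrightarrow> F \<noteq> G \<Longrightarrow> F \<inter> G = {}"
  unfolding faces_def using components_nonoverlap by blast

lemma face_in_one_side:
  assumes "cycle S" "F \<in> faces"
  shows "F \<subseteq> inside (trace S) \<or> F \<subseteq> outside (trace S)"
proof (rule in_one_side[OF assms(1) face_props(2)[OF assms(2)]])
  show "F \<inter> trace S = {}"
    using assms face_props(4)[OF assms(2)] trace_subset_drawing[of S] by (auto simp: cycle_def)
qed

end

text \<open>Symmetric in which set is bounded, because one of the two closed faces may be the outer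
  one.\<close>

lemma Janiszewski_closed:
  fixes a b :: complex
  assumes "closed S" "closed T" "bounded S \<or> bounded T" "connected (S \<inter> T)"
    and "connected_component (- S) a b" "connected_component (- T) a b"
  shows "connected_component (- (S \<union> T)) a b"
proof (cases "bounded S")
  case True
  then show ?thesis
    using Janiszewski[of S T a b] assms by (simp add: compact_eq_bounded_closed)
next
  case False
  then show ?thesis
    using Janiszewski[of T S a b] assms by (simp add: compact_eq_bounded_closed Int_commute Un_commute)
qed

section \<open>Faces of a triangulation and the two sides of an edge\<close>

context planar_triangulation
begin

lemma edge_eqE:
  assumes "e \<in> E"
  obtains a b where "e = {a, b}" "a \<noteq> b"
  using edge_card[OF assms] by (auto simp: card_2_iff)

lemma face_triangle:
  assumes "F \<in> faces"
  obtains a b c where "a \<noteq> b" "b \<noteq> c" "a \<noteq> c" "edges_of F = {{a, b}, {b, c}, {a, c}}"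
    "frontier F = trace (edges_of F)"
proof -
  obtain a b c where abc: "a \<noteq> b" "b \<noteq> c" "a \<noteq> c" "{{a, b}, {b, c}, {a, c}} \<subseteq> E"
    "frontier F = trace {{a, b}, {b, c}, {a, c}}"
    using faces_triangular[OF assms] by (auto simp: bounded_by_triangle_def trace_def)
  let ?S = "{{a, b}, {b, c}, {a, c}}"
  have "edges_of F = ?S"
  proof
    show "?S \<subseteq> edges_of F"
      using abc(4,5) by (auto simp: edges_of_def trace_def)
    show "edges_of F \<subseteq> ?S"
    proof
      fix e assume e: "e \<in> edges_of F"
      then have eE: "e \<in> E" and "path_image (curve e) \<subseteq> trace ?S"
        using abc(5) by (auto simp: edges_of_def)
      then have "edge_interior e \<subseteq> trace ?S"
        by (auto simp: edge_interior_def)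
      then show "e \<in> ?S"
        using edge_interior_disjoint_trace[OF eE abc(4)] edge_interior_nonempty[OF eE] by blast
    qed
  qed
  then show thesis
    using that[OF abc(1-3)] abc(5) by simp
qed

lemma edges_of_subset: "edges_of F \<subseteq> E"
  by (auto simp: edges_of_def)

lemma card_edges_of:
  assumes "F \<in> faces"
  shows "card (edges_of F) = 3"
proof -
  obtain a b c where "a \<noteq> b" "b \<noteq> c" "a \<noteq> c" "edges_of F = {{a, b}, {b, c}, {a, c}}"
    using face_triangle[OF assms] .
  then show ?thesis by (auto simp: doubleton_eq_iff)
qed

lemma cycle_edges_of:
  assumes "F \<in> faces"
  shows "cycle (edges_of F)"
proof -
  obtain a b c where abc: "a \<noteq> b" "b \<noteq> c" "a \<noteq> c" "edges_of F = {{a, b}, {b, c}, {a, c}}"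
    using face_triangle[OF assms] .
  have "cycle (insert {last [c], a} (walk_edges [a, b, c]))"
    using abc edges_of_subset[of F] by (intro walk_cycle) (auto simp: insert_commute)
  moreover have "insert {last [c], a} (walk_edges [a, b, c]) = edges_of F"
    unfolding abc(4) by (auto simp: insert_commute)
  ultimately show ?thesis by simp
qed

lemma face_frontier: "F \<in> faces \<Longrightarrow> frontier F = trace (edges_of F)"
  using face_triangle by metis

lemma edge_touching_face:
  assumes "F \<in> faces" "e \<in> E" "x \<in> edge_interior e" "x \<in> frontier F"
  shows "e \<in> edges_of F"
  using edge_interior_disjoint_trace[OF assms(2) edges_of_subset] assms face_frontier by blast

text \<open>A small ball around \<open>p\<close> misses all vertices and all other edges. A point of
  \<open>D\<close> in it, off the edge, lies in a face not containing \<open>p\<close>, so the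
  frontier of that face enters the ball, where it can only run inside \<open>e\<close>. Since
  frontiers consist of whole edges, \<open>e\<close> belongs to the face.\<close>

lemma face_near_edge:
  assumes e: "e \<in> E" and p: "p \<in> edge_interior e" "p \<in> closure (D - path_image (curve e))"
  shows "\<exists>F\<in>faces. F \<inter> D \<noteq> {} \<and> e \<in> edges_of F"
proof -
  define R where "R = pos ` V \<union> trace (E - {e})"
  have "compact R"
    unfolding R_def
  proof (rule compact_Un)
    show "compact (pos ` V)"
      by (intro finite_imp_compact finite_imageI finite_vertices)
    show "compact (trace (E - {e}))"
      unfolding trace_def by (intro compact_UN) (auto simp: finite_edges compact_edge)
  qed
  then have "open (- R)"
    by (simp add: compact_imp_closed open_Compl)
  have "p \<notin> R"
    using edge_interior_disjoint_trace[OF e, of "E - {e}"] edge_interior_disjoint_vertices[OF e] p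
    by (auto simp: R_def)
  then obtain r where r: "r > 0" "ball p r \<subseteq> - R"
    using \<open>open (- R)\<close> open_contains_ball by blast
  obtain q where q: "q \<in> D" "q \<notin> path_image (curve e)" "q \<in> ball p r"
    using p(2) r(1) by (auto simp: closure_approachable dist_commute)
  have draw: "drawing = R \<union> path_image (curve e)"
    using e by (auto simp: drawing_def R_def trace_def)
  then have "q \<in> \<Union>(components (- drawing))"
    using q r unfolding Union_components by auto
  then obtain F where F: "F \<in> faces" "q \<in> F"
    unfolding faces_def by blast
  have "p \<in> drawing"
    using p(1) draw by (auto simp: edge_interior_def)
  then have "p \<notin> F" using face_props(4)[OF F(1)] by blast
  moreover have "p \<in> ball p r" using r(1) by simp
  ultimately have "ball p r \<inter> frontier F \<noteq> {}"
    using F(2) q(3) by (intro connected_Int_frontier connected_ball) blast+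
  then obtain z where z: "z \<in> ball p r" "z \<in> frontier F" by blast
  have "z \<in> drawing" "z \<notin> R"
    using z r(2) face_props(5)[OF F(1)] by auto
  moreover have "pos ` e \<subseteq> R"
    using edge_subset[OF e] by (auto simp: R_def)
  ultimately have "z \<in> edge_interior e"
    using draw by (auto simp: edge_interior_def)
  then have "e \<in> edges_of F"
    using edge_touching_face[OF F(1) e] z(2) by blast
  then show ?thesis using F q(1) by blast
qed

lemma edge_has_face:
  assumes "e \<in> E"
  shows "\<exists>F\<in>faces. e \<in> edges_of F"
proof -
  obtain p where p: "p \<in> edge_interior e"
    using edge_interior_nonempty[OF assms] by blast
  have "closure (UNIV - path_image (curve e)) = UNIV"
    using empty_interior_arc[OF curve_arc[OF assms]] by (simp add: closure_complement flip: Compl_eq_Diff_UNIV)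
  then show ?thesis
    using face_near_edge[OF assms p, of UNIV] by auto
qed

lemma side_has_face:
  assumes S: "cycle S" and e: "e \<in> S" and D: "D = inside (trace S) \<or> D = outside (trace S)"
  shows "\<exists>F\<in>faces. F \<subseteq> D \<and> e \<in> edges_of F"
proof -
  have eE: "e \<in> E" using S e by (auto simp: cycle_def)
  obtain p where p: "p \<in> edge_interior e"
    using edge_interior_nonempty[OF eE] by blast
  have sub: "path_image (curve e) \<subseteq> trace S"
    using e by (auto simp: trace_def)
  then have "p \<in> frontier D"
    using p cycle_sides(4)[OF S D] by (auto simp: edge_interior_def)
  moreover have "D - path_image (curve e) = D"
    using cycle_sides(5)[OF S D] sub by auto
  ultimately have "p \<in> closure (D - path_image (curve e))"
    by (simp add: frontier_def)
  then obtain F where F: "F \<in> faces" "F \<inter> D \<noteq> {}" "e \<in> edges_of F"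
    using face_near_edge[OF eE p] by blast
  then have "F \<subseteq> D"
    using face_in_one_side[OF S F(1)] D cycle_sides(6)[OF S D] by blast
  then show ?thesis using F by blast
qed

text \<open>A face properly contained in a side would have frontier points within that connected
  side, but its frontier is the Jordan curve itself.\<close>

lemma face_is_side:
  assumes "F \<in> faces"
  shows "F = inside (trace (edges_of F)) \<or> F = outside (trace (edges_of F))"
proof -
  have S: "cycle (edges_of F)" by (rule cycle_edges_of[OF assms])
  obtain D where D: "D = inside (trace (edges_of F)) \<or> D = outside (trace (edges_of F))" "F \<subseteq> D"
    using face_in_one_side[OF S assms] by blast
  have "F = D"
  proof (rule ccontr)
    assume "F \<noteq> D"
    then have "D \<inter> frontier F \<noteq> {}"
      using D(2) face_props(3)[OF assms] cycle_sides(2)[OF S D(1)]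
      by (intro connected_Int_frontier) auto
    then show False
      using cycle_sides(5)[OF S D(1)] face_frontier[OF assms] by auto
  qed
  then show ?thesis using D by auto
qed

lemma closure_face: "F \<in> faces \<Longrightarrow> closure F = F \<union> trace (edges_of F)"
  using face_frontier closure_Un_frontier by metis

lemma connected_compl_closure_face:
  assumes "F \<in> faces"
  shows "connected (- closure F)"
proof -
  let ?X = "trace (edges_of F)"
  have S: "cycle (edges_of F)" by (rule cycle_edges_of[OF assms])
  note i = cycle_sides[OF S disjI1[OF refl]] and o = cycle_sides[OF S disjI2[OF refl]]
  show ?thesis
    using face_is_side[OF assms]
  proof
    assume "F = inside ?X"
    then have "- closure F = outside ?X"
      using closure_face[OF assms] i(6,7) o(5) by auto
    then show ?thesis using o(2) by simp
  next
    assume "F = outside ?X"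
    then have "- closure F = inside ?X"
      using closure_face[OF assms] i(5,6,7) by auto
    then show ?thesis using i(2) by simp
  qed
qed

lemma face_on_side_of_edge:
  assumes S: "cycle S" and D: "D = inside (trace S) \<or> D = outside (trace S)"
    and e: "edge_interior e \<inter> D \<noteq> {}" and F: "F \<in> faces" "e \<in> edges_of F"
  shows "F \<subseteq> D"
proof -
  obtain x where x: "x \<in> edge_interior e" "x \<in> D"
    using e by blast
  have "x \<in> frontier F"
    using F(2) x(1) by (auto simp: edges_of_def edge_interior_def)
  then have "D \<inter> closure F \<noteq> {}"
    using x(2) by (auto simp: frontier_def)
  then have "D \<inter> F \<noteq> {}"
    using open_Int_closure_eq_empty[OF cycle_sides(1)[OF S D]] by blast
  then show ?thesis
    using face_in_one_side[OF S F(1)] D cycle_sides(6)[OF S D] by blast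
qed

text \<open>A face is one of the two sides of its edge set, and there are finitely many edge
  sets.\<close>

lemma finite_faces: "finite faces"
proof (rule finite_subset)
  show "faces \<subseteq> (inside \<circ> trace) ` Pow E \<union> (outside \<circ> trace) ` Pow E"
  proof
    fix F assume "F \<in> faces"
    then show "F \<in> (inside \<circ> trace) ` Pow E \<union> (outside \<circ> trace) ` Pow E"
      using face_is_side[of F] edges_of_subset[of F] by auto
  qed
  show "finite ((inside \<circ> trace) ` Pow E \<union> (outside \<circ> trace) ` Pow E)"
    using finite_edges by simp
qed

lemma face_apex:
  assumes "F \<in> faces" "{a, b} \<in> edges_of F" "a \<noteq> b"
  obtains c where "c \<noteq> a" "c \<noteq> b" "edges_of F = {{a, b}, {a, c}, {b, c}}"
proof -
  obtain x y z where xyz: "x \<noteq> y" "y \<noteq> z" "x \<noteq> z" "edges_of F = {{x, y}, {y, z}, {x, z}}"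
    using face_triangle[OF assms(1)] .
  then consider "{a, b} = {x, y}" | "{a, b} = {y, z}" | "{a, b} = {x, z}"
    using assms(2) by auto
  then show thesis
  proof cases
    case 1
    then have "edges_of F = {{a, b}, {a, z}, {b, z}}" "z \<noteq> a" "z \<noteq> b"
      using xyz by (auto simp: doubleton_eq_iff)
    then show thesis using that by blast
  next
    case 2
    then have "edges_of F = {{a, b}, {a, x}, {b, x}}" "x \<noteq> a" "x \<noteq> b"
      using xyz by (auto simp: doubleton_eq_iff)
    then show thesis using that by blast
  next
    case 3
    then have "edges_of F = {{a, b}, {a, y}, {b, y}}" "y \<noteq> a" "y \<noteq> b"
      using xyz by (auto simp: doubleton_eq_iff)
    then show thesis using that by blast
  qed
qed

text \<open>The two faces are the two sides of one Jordan curve, which leaves no room for a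
  third.\<close>

lemma faces_same_edges:
  assumes F: "F \<in> faces" "G \<in> faces" "F \<noteq> G" "edges_of F = edges_of G"
  shows "faces = {F, G}"
proof -
  let ?X = "trace (edges_of F)"
  have S: "cycle (edges_of F)" by (rule cycle_edges_of[OF F(1)])
  have "G = inside ?X \<or> G = outside ?X"
    unfolding F(4) by (rule face_is_side[OF F(2)])
  then have "F \<union> G = inside ?X \<union> outside ?X"
    using face_is_side[OF F(1)] F(3) by blast
  also have "\<dots> = - ?X"
    by (rule cycle_sides(7)[OF S disjI1[OF refl]])
  finally have "F \<union> G = - ?X" .
  have "H = F \<or> H = G" if H: "H \<in> faces" for H
  proof -
    have "H \<subseteq> F \<union> G"
      unfolding \<open>F \<union> G = - ?X\<close>
      using face_props(4)[OF H] trace_subset_drawing[OF edges_of_subset[of F]] by blast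
    then have "H \<inter> F \<noteq> {} \<or> H \<inter> G \<noteq> {}"
      using face_props(3)[OF H] by blast
    then show ?thesis
      using faces_disjoint[OF H F(1)] faces_disjoint[OF H F(2)] by metis
  qed
  then show ?thesis
    using F(1,2) by blast
qed

lemma bounded_face:
  assumes "F \<in> faces" "G \<in> faces" "F \<noteq> G"
  shows "bounded F \<or> bounded G"
proof -
  have "bounded (- (- drawing))"
    using compact_drawing by (simp add: compact_imp_bounded)
  then show ?thesis
    using assms cobounded_unique_unbounded_components[of "- drawing" F G] by (auto simp: faces_def)
qed

text \<open>Otherwise the theta graph formed by two of the faces has a complement with a fourth component;
  Janiszewski's theorem, applied to the closures of the two faces, excludes this.\<close>

lemma at_most_two_faces:
  assumes F: "F1 \<in> faces" "F2 \<in> faces" "F3 \<in> faces"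
    and ne: "F1 \<noteq> F2" "F1 \<noteq> F3" "F2 \<noteq> F3"
    and e: "e \<in> edges_of F1" "e \<in> edges_of F2" "e \<in> edges_of F3"
  shows False
proof -
  have eE: "e \<in> E" using e edges_of_subset by blast
  obtain a b where ab: "e = {a, b}" "a \<noteq> b"
    using edge_eqE[OF eE] .
  obtain c1 where c1: "c1 \<noteq> a" "c1 \<noteq> b" "edges_of F1 = {{a, b}, {a, c1}, {b, c1}}"
    using face_apex[OF F(1) _ ab(2)] e(1) ab(1) by blast
  obtain c2 where c2: "c2 \<noteq> a" "c2 \<noteq> b" "edges_of F2 = {{a, b}, {a, c2}, {b, c2}}"
    using face_apex[OF F(2) _ ab(2)] e(2) ab(1) by blast
  \<comment> \<open>With equal apexes \<open>F1\<close> and \<open>F2\<close> would be the only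
    faces, leaving none for \<open>F3\<close>.\<close>
  have c12: "c1 \<noteq> c2"
    using faces_same_edges[OF F(1,2) ne(1)] c1 c2 F(3) ne by auto
  \<comment> \<open>The 4-cycle left of the two triangles when the common edge \<open>e\<close> is
    removed. All three faces lie on the side \<open>D\<close> of it that contains the interior of
    \<open>e\<close>.\<close>
  define S where "S = insert {last [b, c2], a} (walk_edges [a, c1, b, c2])"
  have S_eq: "S = {{a, c1}, {b, c1}, {a, c2}, {b, c2}}"
    unfolding S_def by (auto simp: insert_commute)
  have SE: "{{a, c1}, {b, c1}, {a, c2}, {b, c2}} \<subseteq> E"
    using c1(3) c2(3) edges_of_subset[of F1] edges_of_subset[of F2] by auto
  have S: "cycle S"
    unfolding S_def using c1 c2 c12 ab(2) SE by (intro walk_cycle) (auto simp: insert_commute)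
  have eS: "e \<notin> S"
    unfolding S_eq ab(1) using c1 c2 ab(2) by (auto simp: doubleton_eq_iff)
  have disj: "edge_interior e \<inter> trace S = {}"
    using S by (intro edge_interior_disjoint_trace eE eS) (auto simp: cycle_def)
  obtain D D' where D: "D = inside (trace S) \<or> D = outside (trace S)"
    "D' = inside (trace S) \<or> D' = outside (trace S)" "D \<inter> D' = {}" "edge_interior e \<subseteq> D"
    using in_one_side[OF S connected_edge_interior[OF eE] disj] cycle_sides(6)[OF S disjI1[OF refl]]
    by (metis Int_commute)
  have eD: "edge_interior e \<inter> D \<noteq> {}"
    using D(4) edge_interior_nonempty[OF eE] by blast
  note FD = face_on_side_of_edge[OF S D(1) eD]
  obtain z where z: "z \<in> F3" using face_props(3)[OF F(3)] by blast
  have zD: "z \<in> D" using FD[OF F(3) e(3)] z by blast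
  \<comment> \<open>A point of the opposite side stands for the fourth component.\<close>
  obtain x where x: "x \<in> D'" using cycle_sides(3)[OF S D(2)] by blast
  have xS: "x \<notin> trace S" using cycle_sides(5)[OF S D(2)] x by blast
  have "path_image (curve e) \<subseteq> edge_interior e \<union> {pos a, pos b}"
    using ab(1) by (auto simp: edge_interior_def)
  moreover have "pos a \<in> trace S" "pos b \<in> trace S"
    using edge_ends[of "{a, c1}" a] edge_ends[of "{b, c1}" b] SE by (auto simp: trace_def S_eq)
  ultimately have eDS: "path_image (curve e) \<subseteq> D \<union> trace S"
    using D(4) by auto
  have tr: "trace (edges_of F1) = path_image (curve e) \<union> (path_image (curve {a, c1}) \<union> path_image (curve {b, c1}))"
    "trace (edges_of F2) = path_image (curve e) \<union> (path_image (curve {a, c2}) \<union> path_image (curve {b, c2}))"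
    "trace S = path_image (curve {a, c1}) \<union> path_image (curve {b, c1}) \<union>
      (path_image (curve {a, c2}) \<union> path_image (curve {b, c2}))"
    by (auto simp: trace_def c1(3) c2(3) ab(1) S_eq)
  have "x \<notin> D" using x D(3) by blast
  then have x1: "x \<notin> closure F1" and x2: "x \<notin> closure F2"
    using FD[OF F(1) e(1)] FD[OF F(2) e(2)] eDS xS tr
    unfolding closure_face[OF F(1)] closure_face[OF F(2)] by blast+
  have trd: "trace (edges_of F1) \<subseteq> drawing" "trace (edges_of F2) \<subseteq> drawing"
    by (intro trace_subset_drawing edges_of_subset)+
  have z1: "z \<notin> closure F1" and z2: "z \<notin> closure F2"
    using z faces_disjoint[OF F(1,3) ne(2)] faces_disjoint[OF F(2,3) ne(3)] face_props(4)[OF F(3)] trd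
    unfolding closure_face[OF F(1)] closure_face[OF F(2)] by blast+
  have Int: "closure F1 \<inter> closure F2 = path_image (curve e)"
  proof
    show "path_image (curve e) \<subseteq> closure F1 \<inter> closure F2"
      unfolding closure_face[OF F(1)] closure_face[OF F(2)] tr by blast
    show "closure F1 \<inter> closure F2 \<subseteq> path_image (curve e)"
    proof
      fix y assume "y \<in> closure F1 \<inter> closure F2"
      then have "y \<in> trace (edges_of F1)" "y \<in> trace (edges_of F2)"
        using faces_disjoint[OF F(1,2) ne(1)] face_props(4)[OF F(1)] face_props(4)[OF F(2)] trd
        unfolding closure_face[OF F(1)] closure_face[OF F(2)] by blast+
      then obtain f g where fg: "f \<in> edges_of F1" "g \<in> edges_of F2"
        "y \<in> path_image (curve f)" "y \<in> path_image (curve g)"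
        by (auto simp: trace_def)
      show "y \<in> path_image (curve e)"
      proof (cases "f = e \<or> g = e")
        case False
        then have "f \<noteq> g" "f \<inter> g \<subseteq> e"
          using fg(1,2) c1 c2 c12 ab by (auto simp: doubleton_eq_iff)
        then have "y \<in> pos ` e"
          using curves_meet[of f g] fg edges_of_subset by blast
        then show ?thesis using edge_ends[OF eE] by blast
      qed (use fg in auto)
    qed
  qed
  have comp: "connected_component (- closure G) z x" if "G \<in> faces" "z \<notin> closure G" "x \<notin> closure G" for G
    using connected_compl_closure_face[OF that(1)] that(2,3) unfolding connected_component_def by blast
  have "connected_component (- (closure F1 \<union> closure F2)) z x"
  proof (rule Janiszewski_closed)
    show "bounded (closure F1) \<or> bounded (closure F2)"
      using bounded_face[OF F(1,2) ne(1)] bounded_closure by blast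
    show "connected (closure F1 \<inter> closure F2)"
      unfolding Int by (rule connected_arc_image[OF curve_arc[OF eE]])
  qed (use comp F x1 x2 z1 z2 in auto)
  \<comment> \<open>The edges of \<open>S\<close> lie in the two closures, so \<open>X\<close>
    misses \<open>S\<close> although it joins opposite sides of it.\<close>
  then obtain X where X: "connected X" "X \<subseteq> - (closure F1 \<union> closure F2)" "z \<in> X" "x \<in> X"
    unfolding connected_component_def by blast
  have "X \<inter> trace S = {}"
    using X(2) tr unfolding closure_face[OF F(1)] closure_face[OF F(2)] by blast
  then show False
    using in_one_side[OF S X(1)] X(3,4) zD x D(1-3) cycle_sides(6)[OF S D(1)] by blast
qed

text \<open>The second face lies on the other side of the triangle bounding the first.\<close>

lemma edge_two_faces:
  assumes e: "e \<in> E"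
  shows "card {F \<in> faces. e \<in> edges_of F} = 2"
proof -
  obtain F where F: "F \<in> faces" "e \<in> edges_of F"
    using edge_has_face[OF e] by blast
  have S: "cycle (edges_of F)" by (rule cycle_edges_of[OF F(1)])
  obtain G where G: "G \<in> faces" "e \<in> edges_of G" "G \<noteq> F"
  proof -
    obtain D where D: "D = inside (trace (edges_of F)) \<or> D = outside (trace (edges_of F))" "D \<inter> F = {}"
      using face_is_side[OF F(1)] cycle_sides(6)[OF S disjI1[OF refl]] by (metis Int_commute)
    then show thesis
      using side_has_face[OF S F(2) D(1)] that face_props(3) by blast
  qed
  have "{F \<in> faces. e \<in> edges_of F} = {F, G}"
    using F G at_most_two_faces by blast
  then show ?thesis using G(3) by simp
qed

section \<open>The dual multigraph\<close>

definition faces_at :: "'a set \<Rightarrow> complex set set" where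
  "faces_at e = {F \<in> faces. e \<in> edges_of F}"

text \<open>The edges of the graph serve as the dual edges themselves, so faces sharing several
  edges are joined by parallel ones.\<close>

sublocale dual: multigraph faces E faces_at
  by unfold_locales (auto simp: finite_faces finite_edges faces_at_def edge_two_faces)

lemma dual_bd:
  assumes "F \<in> faces" "D \<subseteq> E"
  shows "dual.bd D F \<longleftrightarrow> odd (card (D \<inter> edges_of F))"
proof -
  have "{e \<in> D. F \<in> faces_at e} = D \<inter> edges_of F"
    using assms by (auto simp: faces_at_def)
  then show ?thesis by (simp add: dual.bd_def)
qed

text \<open>An edge of \<open>S\<close> has one face on each side of the curve; any other edge has
  its interior, and hence both its faces, on a single side.\<close>

lemma cycle_dual_cut:
  assumes S: "cycle S"
  shows "dual.cut {F \<in> faces. F \<subseteq> inside (trace S)} = S"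
proof -
  let ?I = "{F \<in> faces. F \<subseteq> inside (trace S)}"
  have SE: "S \<subseteq> E" using S by (simp add: cycle_def)
  note sides = cycle_sides[OF S disjI1[OF refl]]
  have "card (faces_at e \<inter> ?I) = 1 \<longleftrightarrow> e \<in> S" if e: "e \<in> E" for e
  proof (cases "e \<in> S")
    case True
    obtain F where F: "F \<in> faces" "F \<subseteq> inside (trace S)" "e \<in> edges_of F"
      using side_has_face[OF S True] by blast
    obtain G where G: "G \<in> faces" "G \<subseteq> outside (trace S)" "e \<in> edges_of G"
      using side_has_face[OF S True] by blast
    have G': "\<not> G \<subseteq> inside (trace S)"
      using G face_props(3)[OF G(1)] sides(6) by blast
    have "faces_at e = {F, G}"
      using at_most_two_faces F G G' unfolding faces_at_def by blast
    then have "faces_at e \<inter> ?I = {F}"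
      using F G' by auto
    then show ?thesis using True by simp
  next
    case False
    have disj: "edge_interior e \<inter> trace S = {}"
      by (rule edge_interior_disjoint_trace[OF e SE False])
    show ?thesis
      using in_one_side[OF S connected_edge_interior[OF e] disj]
    proof
      assume "edge_interior e \<subseteq> inside (trace S)"
      then have "edge_interior e \<inter> inside (trace S) \<noteq> {}"
        using edge_interior_nonempty[OF e] by blast
      then have "faces_at e \<inter> ?I = faces_at e"
        using face_on_side_of_edge[OF S disjI1[OF refl]] by (auto simp: faces_at_def)
      then show ?thesis
        using False edge_two_faces[OF e] by (simp add: faces_at_def)
    next
      assume "edge_interior e \<subseteq> outside (trace S)"
      then have "edge_interior e \<inter> outside (trace S) \<noteq> {}"
        using edge_interior_nonempty[OF e] by blast
      then have "F \<subseteq> outside (trace S)" if "F \<in> faces_at e" for F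
        using face_on_side_of_edge[OF S disjI2[OF refl]] that by (auto simp: faces_at_def)
      then have "faces_at e \<inter> ?I = {}"
        using sides(6) face_props(3) by blast
      then show ?thesis using False by simp
    qed
  qed
  then show ?thesis
    using SE by (auto simp: dual.cut_def)
qed

text \<open>In the dual, \<open>f\<close> has zero boundary, and such a set meets every cut
  evenly.\<close>

lemma even_on_cycle:
  assumes S: "cycle S" and f: "f \<subseteq> E" "\<And>F. F \<in> faces \<Longrightarrow> even (card (f \<inter> edges_of F))"
  shows "even (card (f \<inter> S))"
proof -
  let ?I = "{F \<in> faces. F \<subseteq> inside (trace S)}"
  have "{F \<in> ?I. dual.bd f F} = {}"
    using f dual_bd by auto
  then show ?thesis
    using dual.handshake[OF f(1), of ?I] cycle_dual_cut[OF S]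
    by (metis (no_types, lifting) card.empty even_zero mem_Collect_eq subsetI)
qed

end

section \<open>Colorings from dual perfect matchings\<close>

context plane_graph
begin

lemma walk_parity:
  assumes "distinct (x # xs)" "walk_edges (x # xs) \<subseteq> A"
    and "\<And>u v. {u, v} \<in> A \<Longrightarrow> {u, v} \<in> f \<longleftrightarrow> col u \<noteq> (col v :: bool)"
  shows "even (card (f \<inter> walk_edges (x # xs))) \<longleftrightarrow> col x = col (last (x # xs))"
  using assms(1,2)
proof (induction xs arbitrary: x)
  case (Cons y ys)
  have IH: "even (card (f \<inter> walk_edges (y # ys))) \<longleftrightarrow> col y = col (last (y # ys))"
    using Cons by auto
  have "{x, y} \<notin> walk_edges (y # ys)"
    using walk_edges_subset[of "{x, y}" "y # ys"] Cons.prems by auto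
  then have "card (f \<inter> walk_edges (x # y # ys)) =
      (if {x, y} \<in> f then 1 else 0) + card (f \<inter> walk_edges (y # ys))"
    using finite_walk_edges[of "y # ys"] by (simp add: Int_insert_right)
  moreover have "{x, y} \<in> f \<longleftrightarrow> col x \<noteq> col y"
    using Cons.prems assms(3)[of x y] by simp
  ultimately show ?case
    using IH by auto
qed simp

text \<open>Edges are added one at a time. If the ends of a new edge have the wrong colors, they lie
  in different components of \<open>A\<close>, since a path between them would close to a cycle
  meeting \<open>f\<close> oddly; flipping the colors of one component repairs the edge.\<close>

lemma cut_of_even_on_cycles:
  assumes f: "\<And>S. cycle S \<Longrightarrow> even (card (f \<inter> S))" and A: "A \<subseteq> E"
  shows "\<exists>col :: 'v \<Rightarrow> bool. \<forall>u v. {u, v} \<in> A \<longrightarrow> ({u, v} \<in> f \<longleftrightarrow> col u \<noteq> col v)"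
proof -
  have "finite A" using A finite_edges finite_subset by blast
  then show ?thesis
    using A
  proof (induction A rule: finite_induct)
    case empty
    then show ?case by simp
  next
    case (insert e A)
    then have "\<exists>col :: 'v \<Rightarrow> bool. \<forall>u v. {u, v} \<in> A \<longrightarrow> ({u, v} \<in> f \<longleftrightarrow> col u \<noteq> col v)"
      by simp
    then obtain col :: "'v \<Rightarrow> bool"
      where col: "\<And>u v. {u, v} \<in> A \<Longrightarrow> {u, v} \<in> f \<longleftrightarrow> col u \<noteq> col v"
      by blast
    have eE: "e \<in> E" and AE: "A \<subseteq> E" using insert.prems by auto
    obtain a b where ab: "e = {a, b}" "a \<noteq> b"
      using edge_card[OF eE] by (auto simp: card_2_iff)
    show ?case
    proof (cases "e \<in> f \<longleftrightarrow> col a \<noteq> col b")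
      case True
      have "{u, v} \<in> f \<longleftrightarrow> col u \<noteq> col v" if "{u, v} \<in> insert e A" for u v
        using that True col[of u v] ab by (auto simp: doubleton_eq_iff insert_commute)
      then show ?thesis by blast
    next
      case False
      \<comment> \<open>The component of \<open>a\<close>, described by walks without repeated
        vertices so that such a walk from \<open>b\<close> together with \<open>e\<close> is a
        \<open>cycle\<close>.\<close>
      define C where "C = {v. \<exists>xs. distinct (v # xs) \<and> last (v # xs) = a \<and> walk_edges (v # xs) \<subseteq> A}"
      have aC: "a \<in> C"
        unfolding C_def by (auto intro: exI[of _ "[]"])
      have step: "v \<in> C" if u: "u \<in> C" and uv: "{u, v} \<in> A" for u v
      proof -
        obtain xs where xs: "distinct (u # xs)" "last (u # xs) = a" "walk_edges (u # xs) \<subseteq> A"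
          using u by (auto simp: C_def)
        show ?thesis
        proof (cases "v \<in> set (u # xs)")
          case True
          then obtain ys zs where split: "u # xs = ys @ v # zs"
            by (meson split_list)
          then have "distinct (v # zs)" "last (v # zs) = a" "walk_edges (v # zs) \<subseteq> A"
            using xs walk_edges_suffix[of "v # zs" ys] by auto
          then show ?thesis by (auto simp: C_def)
        next
          case False
          then have "distinct (v # u # xs)" "last (v # u # xs) = a" "walk_edges (v # u # xs) \<subseteq> A"
            using xs uv by (auto simp: insert_commute)
          then show ?thesis unfolding C_def by blast
        qed
      qed
      have bC: "b \<notin> C"
      proof
        assume "b \<in> C"
        then obtain xs where xs: "distinct (b # xs)" "last (b # xs) = a" "walk_edges (b # xs) \<subseteq> A"
          by (auto simp: C_def)
        then obtain y ys where y: "xs = y # ys"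
          using ab(2) by (cases xs) auto
        \<comment> \<open>A walk of one step would be \<open>e\<close> itself, which is not in
          \<open>A\<close>.\<close>
        have "ys \<noteq> []"
          using xs y insert.hyps(2) ab(1) by (auto simp: insert_commute)
        then obtain z zs where z: "ys = z # zs" by (cases ys) auto
        note xs' = xs[unfolded y z]
        have last: "last (z # zs) = a" using xs'(2) by simp
        have eq: "insert {last (z # zs), b} (walk_edges (b # y # z # zs)) = insert e (walk_edges (b # xs))"
          using last ab(1) y z by simp
        have "cycle (insert {last (z # zs), b} (walk_edges (b # y # z # zs)))"
          using xs' AE eE ab(1) last by (intro walk_cycle) (auto simp del: last.simps walk_edges.simps)
        then have ev: "even (card (f \<inter> insert e (walk_edges (b # xs))))"
          using f eq by simp
        have "e \<notin> walk_edges (b # xs)"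
          using xs insert.hyps by blast
        then have "card (f \<inter> insert e (walk_edges (b # xs))) =
            (if e \<in> f then 1 else 0) + card (f \<inter> walk_edges (b # xs))"
          using finite_walk_edges[of "b # xs"] by (simp add: Int_insert_right)
        moreover have "even (card (f \<inter> walk_edges (b # xs))) \<longleftrightarrow> col b = col a"
          using walk_parity[OF xs(1,3) col] xs(2) by simp
        ultimately show False
          using ev False by (auto split: if_splits)
      qed
      define col' where "col' v \<longleftrightarrow> (col v \<noteq> (v \<in> C))" for v
      have "{u, v} \<in> f \<longleftrightarrow> col' u \<noteq> col' v" if uv: "{u, v} \<in> insert e A" for u v
      proof (cases "{u, v} = e")
        case True
        then have "u = a \<and> v = b \<or> u = b \<and> v = a"
          using ab(1) by (simp add: doubleton_eq_iff)
        then have "col' u \<noteq> col' v \<longleftrightarrow> col a = col b"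
          using aC bC unfolding col'_def by blast
        then show ?thesis
          using False True by blast
      next
        case False
        then have "{u, v} \<in> A" "{v, u} \<in> A" using uv by (auto simp: insert_commute)
        then show ?thesis
          using col[of u v] step[of u v] step[of v u] by (auto simp: col'_def)
      qed
      then show ?thesis by blast
    qed
  qed
qed

end

section \<open>Disjoint bichromatic edges and discrepancy\<close>

lemma card_le_disjoint_meets:
  assumes "finite C" "pairwise disjnt N" "\<And>e. e \<in> N \<Longrightarrow> e \<inter> C \<noteq> {}"
  shows "card N \<le> card C"
proof -
  have "\<forall>e\<in>N. \<exists>x. x \<in> e \<inter> C"
    using assms(3) by blast
  then obtain t where t: "\<And>e. e \<in> N \<Longrightarrow> t e \<in> e \<inter> C"
    by metis
  have "inj_on t N"
  proof (rule inj_onI)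
    fix e f assume "e \<in> N" "f \<in> N" "t e = t f"
    then have "\<not> disjnt e f"
      using t[of e] t[of f] by (auto simp: disjnt_def)
    then show "e = f"
      using assms(2) \<open>e \<in> N\<close> \<open>f \<in> N\<close> by (auto simp: pairwise_def)
  qed
  moreover have "t ` N \<subseteq> C" using t by blast
  ultimately show ?thesis
    using assms(1) card_inj_on_le by blast
qed

text \<open>Each edge of \<open>N\<close> has an end in either class, so the smaller class has at
  least \<open>card N\<close> vertices.\<close>

lemma discrepancy_le_matching:
  assumes V: "finite V" and N: "pairwise disjnt N"
    and bi: "\<And>e. e \<in> N \<Longrightarrow> \<exists>u\<in>e \<inter> V. \<exists>v\<in>e \<inter> V. col u \<and> \<not> col v"
  shows "discrepancy V col \<le> int (card V) - 2 * int (card N)"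
proof -
  have "card N \<le> card {v \<in> V. col v}" "card N \<le> card {v \<in> V. \<not> col v}"
    using V by (intro card_le_disjoint_meets N; use bi in fastforce)+
  moreover have "card V = card {v \<in> V. col v} + card {v \<in> V. \<not> col v}"
  proof -
    have "V = {v \<in> V. col v} \<union> {v \<in> V. \<not> col v}" by blast
    then have "card V = card ({v \<in> V. col v} \<union> {v \<in> V. \<not> col v})" by simp
    also have "\<dots> = card {v \<in> V. col v} + card {v \<in> V. \<not> col v}"
      using V by (intro card_Un_disjoint) auto
    finally show ?thesis .
  qed
  ultimately show ?thesis
    by (simp add: discrepancy_def)
qed

section \<open>Light perfect matchings of the dual and the resulting colorings\<close>

context planar_triangulation
begin

text \<open>For an endpoint \<open>a\<close> of an edge \<open>e\<close>, every face has an even number of edges at \<open>a\<close>; hence no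
  cut of the dual graph consists of \<open>e\<close> alone.\<close>

lemma dual_cut_not_singleton:
  assumes U: "U \<subseteq> faces"
  shows "card (dual.cut U) \<noteq> 1"
proof
  assume "card (dual.cut U) = 1"
  then obtain e where e: "dual.cut U = {e}"
    by (auto simp: card_1_singleton_iff)
  then have eE: "e \<in> E" by (auto simp: dual.cut_def)
  obtain a b where ab: "e = {a, b}" "a \<noteq> b"
    using edge_eqE[OF eE] .
  let ?D = "{g \<in> E. a \<in> g}"
  have "\<not> dual.bd ?D F" if F: "F \<in> faces" for F
  proof -
    obtain x y z where xyz: "x \<noteq> y" "y \<noteq> z" "x \<noteq> z" "edges_of F = {{x, y}, {y, z}, {x, z}}"
      using face_triangle[OF F] .
    have "?D \<inter> edges_of F = {g \<in> edges_of F. a \<in> g}"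
      using edges_of_subset by blast
    also have "\<dots> = (if a = x then {{x, y}, {x, z}} else if a = y then {{x, y}, {y, z}}
        else if a = z then {{x, z}, {y, z}} else {})"
      unfolding xyz(4) using xyz(1-3) by auto
    finally have "even (card (?D \<inter> edges_of F))"
      using xyz(1-3) by (auto simp: doubleton_eq_iff)
    then show ?thesis
      using dual_bd[OF F, of ?D] by simp
  qed
  then have "{F \<in> U. dual.bd ?D F} = {}"
    using U by blast
  moreover have "?D \<inter> dual.cut U = {e}"
    unfolding e using eE ab by auto
  moreover have "?D \<subseteq> E" by blast
  ultimately show False
    using dual.handshake[of ?D U] U by (metis card.empty even_zero is_singletonI is_singleton_altdef odd_one)
qed

text \<open>The dual is cubic, so the size of a cut has the parity of \<open>U\<close>; being odd
  and not 1, it is at least 3.\<close>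

lemma dual_odd_cut:
  assumes U: "U \<subseteq> faces" "odd (card U)"
  shows "3 \<le> card (dual.cut U)"
proof -
  have "dual.bd E F" if "F \<in> faces" for F
    using dual_bd[OF that, of E] card_edges_of[OF that] edges_of_subset[of F]
    by (simp add: Int_absorb1)
  then have "{F \<in> U. dual.bd E F} = U"
    using U by blast
  moreover have "E \<inter> dual.cut U = dual.cut U"
    by (auto simp: dual.cut_def)
  ultimately have "odd (card (dual.cut U))"
    using dual.handshake[of E U] U by simp
  moreover have "n \<ge> 3" if "odd n" "n \<noteq> 1" for n :: nat
    using that by presburger
  ultimately show ?thesis
    using dual_cut_not_singleton[OF U(1)] by blast
qed

lemma sum_face_edges:
  assumes "D \<subseteq> E"
  shows "(\<Sum>F\<in>faces. card (D \<inter> edges_of F)) = 2 * card D"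
proof -
  have "{e \<in> D. F \<in> faces_at e} = D \<inter> edges_of F" if "F \<in> faces" for F
    using that by (auto simp: faces_at_def)
  then show ?thesis
    using dual.sum_degrees[OF assms] by simp
qed

lemma light_perfect_matching:
  assumes M: "M \<subseteq> E"
  obtains J where "J \<subseteq> E" "\<And>F. F \<in> faces \<Longrightarrow> card (J \<inter> edges_of F) = 1"
    "3 * card (J \<inter> M) \<le> card M"
proof -
  \<comment> \<open>The base weight exceeds the total surplus on \<open>M\<close>, so the number of
    edges of \<open>J\<close> dominates in the comparison.\<close>
  define K where "K = card M + 1"
  define w where "w e = K + (if e \<in> M then 1 else 0)" for e
  have w: "sum w D = K * card D + card (D \<inter> M)" if "D \<subseteq> E" for D
  proof -
    have "finite D" using that finite_edges finite_subset by blast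
    then show ?thesis
      by (simp add: w_def sum.distrib sum.If_cases Int_def)
  qed
  let ?T = "\<lambda>F. F \<in> faces"
  have "dual.join ?T E"
    using dual_bd[of _ E] card_edges_of edges_of_subset dual.bd_in_V[of E]
    by (auto simp: dual.join_def Int_absorb1)
  moreover have "3 \<le> card (dual.cut U)" if "U \<subseteq> faces" "odd (card {F \<in> U. F \<in> faces})" for U
  proof -
    have "{F \<in> U. F \<in> faces} = U" using that by blast
    then show ?thesis using dual_odd_cut that by simp
  qed
  ultimately obtain J where J: "dual.join ?T J" "3 * sum w J \<le> sum w E"
    using dual.light_join[of ?T E w] by blast
  have JE: "J \<subseteq> E" using J by (simp add: dual.join_def)
  have odd_J: "odd (card (J \<inter> edges_of F))" if "F \<in> faces" for F
    using J(1) dual_bd[OF that JE] that by (simp add: dual.join_def)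
  have le: "3 * (K * card J) + 3 * card (J \<inter> M) \<le> K * card E + card M"
    using J(2) w[OF JE] w[of E] M by (simp add: Int_absorb1)
  have E2: "2 * card E = 3 * card faces"
    using sum_face_edges[of E] card_edges_of edges_of_subset by (simp add: Int_absorb1)
  have ge1: "1 \<le> card (J \<inter> edges_of F)" if "F \<in> faces" for F
    using odd_J[OF that] by (metis One_nat_def Suc_leI even_zero neq0_conv)
  have "card faces \<le> 2 * card J"
    using sum_mono[of faces "\<lambda>_. 1" "\<lambda>F. card (J \<inter> edges_of F)"] ge1 sum_face_edges[OF JE] by simp
  then have "card E \<le> 3 * card J"
    using E2 by linarith
  then have "K * card E \<le> 3 * (K * card J)"
    using mult_le_mono2[of "card E" "3 * card J" K] by simp
  then have light: "3 * card (J \<inter> M) \<le> card M"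
    using le by linarith
  have "card (J \<inter> edges_of F) = 1" if F: "F \<in> faces" for F
  proof (rule ccontr)
    assume "card (J \<inter> edges_of F) \<noteq> 1"
    moreover have "n \<ge> 3" if "odd n" "n \<noteq> 1" for n :: nat
      using that by presburger
    ultimately have "3 \<le> card (J \<inter> edges_of F)"
      using odd_J[OF F] by blast
    moreover have "card (faces - {F}) \<le> (\<Sum>G\<in>faces - {F}. card (J \<inter> edges_of G))"
      using sum_mono[of "faces - {F}" "\<lambda>_. 1" "\<lambda>F. card (J \<inter> edges_of F)"] ge1 by simp
    moreover have "card faces = Suc (card (faces - {F}))"
      using finite_faces F by (metis card_Suc_Diff1)
    moreover have "2 * card J = card (J \<inter> edges_of F) + (\<Sum>G\<in>faces - {F}. card (J \<inter> edges_of G))"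
      using sum.remove[OF finite_faces F, of "\<lambda>F. card (J \<inter> edges_of F)"] sum_face_edges[OF JE] by simp
    \<comment> \<open>A face with three edges of \<open>J\<close> puts \<open>3 * card J\<close> at
      least 3 above its minimum \<open>card E\<close>. This costs \<open>3 * K\<close>, while
      \<open>le\<close> allows an excess of at most \<open>card M\<close>.\<close>
    ultimately have "card E + 3 \<le> 3 * card J"
      using E2 by linarith
    then have "K * (card E + 3) \<le> K * (3 * card J)"
      by (rule mult_le_mono2)
    then have "K * card E + 3 * K \<le> 3 * (K * card J)"
      by (simp add: algebra_simps)
    then show False
      using le by (simp add: K_def)
  qed
  then show thesis
    using that JE light by blast
qed

lemma light_polychromatic:
  assumes M: "M \<subseteq> E"
  obtains col where "polychromatic col" "3 * card {e \<in> M. \<forall>u\<in>e. \<forall>v\<in>e. col u = col v} \<le> card M"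
proof -
  obtain J where J: "J \<subseteq> E" "\<And>F. F \<in> faces \<Longrightarrow> card (J \<inter> edges_of F) = 1"
    "3 * card (J \<inter> M) \<le> card M"
    using light_perfect_matching[OF M] by metis
  have two: "card ((E - J) \<inter> edges_of F) = 2" if "F \<in> faces" for F
  proof -
    have "(E - J) \<inter> edges_of F = edges_of F - J \<inter> edges_of F"
      using edges_of_subset by blast
    moreover have "finite (edges_of F)"
      using edges_of_subset finite_edges finite_subset by blast
    ultimately show ?thesis
      using J(2)[OF that] card_edges_of[OF that] by (simp add: card_Diff_subset)
  qed
  \<comment> \<open>This parity makes \<open>E - J\<close> exactly the set of bichromatic edges of a
    coloring.\<close>
  have "even (card ((E - J) \<inter> S))" if "cycle S" for S
    by (rule even_on_cycle[OF that]) (simp_all add: two)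
  from cut_of_even_on_cycles[OF this order_refl]
  obtain col :: "'a \<Rightarrow> bool"
    where col: "\<And>u v. {u, v} \<in> E \<Longrightarrow> {u, v} \<in> E - J \<longleftrightarrow> col u \<noteq> col v"
    by blast
  have "polychromatic col"
    unfolding polychromatic_def
  proof
    fix F assume F: "F \<in> faces"
    have "(E - J) \<inter> edges_of F \<noteq> {}"
      using two[OF F] by (metis card.empty zero_neq_numeral)
    then obtain e where e: "e \<in> E - J" "e \<in> edges_of F"
      by blast
    then have eE: "e \<in> E" by blast
    obtain u v where uv: "e = {u, v}" "u \<noteq> v" using edge_eqE[OF eE] .
    have "u \<in> face_vertices F" "v \<in> face_vertices F"
      using edge_ends[OF eE] edge_subset[OF eE] e(2) uv by (auto simp: face_vertices_def edges_of_def)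
    moreover have "col u \<noteq> col v"
      using col[of u v] e uv by auto
    ultimately show "\<not> monochromatic_face col F"
      by (auto simp: monochromatic_face_def)
  qed
  moreover have "{e \<in> M. \<forall>u\<in>e. \<forall>v\<in>e. col u = col v} \<subseteq> J \<inter> M"
  proof
    fix e assume e: "e \<in> {e \<in> M. \<forall>u\<in>e. \<forall>v\<in>e. col u = col v}"
    then have "e \<in> E" using M by blast
    then obtain u v where "e = {u, v}" by (rule edge_eqE)
    moreover from this have "col u = col v"
      using e by blast
    ultimately show "e \<in> J \<inter> M"
      using e M col[of u v] by blast
  qed
  then have "card {e \<in> M. \<forall>u\<in>e. \<forall>v\<in>e. col u = col v} \<le> card (J \<inter> M)"
    using J(1) finite_edges by (intro card_mono) (auto intro: finite_subset)
  ultimately show thesis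
    using that J(3) by (meson le_trans mult_le_mono2)
qed

end

theorem theorem1:
  fixes V :: "'v set" and E M :: "'v set set"
    and pos :: "'v \<Rightarrow> complex" and curve :: "'v set \<Rightarrow> real \<Rightarrow> complex"
  assumes "planar_triangulation V E pos curve"
    and "matching E M"
  shows "\<exists>col :: 'v \<Rightarrow> bool. plane_graph.polychromatic V E pos curve col \<and>
    real_of_int (discrepancy V col) \<le> real (card V) - 4 / 3 * real (card M)"
proof -
  interpret planar_triangulation V E pos curve by fact
  have M: "M \<subseteq> E" "pairwise disjnt M"
    using assms(2) by (auto simp: matching_def)
  obtain col where col: "polychromatic col"
    "3 * card {e \<in> M. \<forall>u\<in>e. \<forall>v\<in>e. col u = col v} \<le> card M"
    using light_polychromatic[OF M(1)] .
  define N where "N = {e \<in> M. \<not> (\<forall>u\<in>e. \<forall>v\<in>e. col u = col v)}"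
  have "discrepancy V col \<le> int (card V) - 2 * int (card N)"
  proof (rule discrepancy_le_matching[OF finite_vertices])
    show "pairwise disjnt N"
      using M(2) by (rule pairwise_subset) (auto simp: N_def)
    show "\<exists>u\<in>e \<inter> V. \<exists>v\<in>e \<inter> V. col u \<and> \<not> col v" if "e \<in> N" for e
    proof -
      have "e \<subseteq> V" using that M(1) edge_subset by (auto simp: N_def)
      moreover have "\<exists>u\<in>e. \<exists>v\<in>e. col u \<noteq> col v"
        using that by (simp add: N_def)
      ultimately show ?thesis by (metis IntI subsetD)
    qed
  qed
  then have "real_of_int (discrepancy V col) \<le> real (card V) - 2 * real (card N)"
    by linarith
  moreover have "card M = card {e \<in> M. \<forall>u\<in>e. \<forall>v\<in>e. col u = col v} + card N"
  proof -
    let ?A = "{e \<in> M. \<forall>u\<in>e. \<forall>v\<in>e. col u = col v}"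
    have "finite M" using M(1) finite_edges finite_subset by blast
    then have "card (?A \<union> N) = card ?A + card N"
      by (intro card_Un_disjoint) (auto simp: N_def)
    moreover have "?A \<union> N = M"
      unfolding N_def by blast
    ultimately show ?thesis by simp
  qed
  \<comment> \<open>At least two thirds of \<open>M\<close> are bichromatic, and each such edge
    lowers the bound by 2; this gives the factor 4/3.\<close>
  then have "2 * real (card M) \<le> 3 * real (card N)"
    using col(2) by linarith
  ultimately show ?thesis
    using col(1) by (intro exI[of _ col]) simp
qed

end
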